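(* Let $P$ be a finite poset with an action of a group $G$, and let $\phi:P\to P$ be a $G$-equivariant descending closure operator. Then the induced map $\phi_G$ is a trisp closure map on $\Delta(P/G)$. Here the red vertices are $R=\{[\phi(p)] : p\in P\}$, the blue vertices $B$ are all other vertices of $\Delta(P/G)$, and $\phi_G:B\to R$ is given by $\phi_G([b])=[\phi(b)]$.
   Context: A descending closure operator on a poset $P$ is an order-preserving map $\phi:P\to P$ with $\phi^2=\phi$ and $\phi(x)\le x$ for all $x\in P$. $G$ acts on $P$ by order automorphisms, and $\phi$ is $G$-equivariant if $\phi(gx)=g\phi(x)$ for all $g\in G,x\in P$. A poset is viewed as a category with exactly one morphism $x\to y$ if $x\le y$, and none otherwise. The quotient $P/G$ is the colimit of the $G$-action in the category of acyclic categories (categories in which only identities are invertible and all endomorphisms are identities). Explicitly: its objects are the orbits $[a]=Ga$ of elements of $P$; its morphisms are equivalence classes $[x]$ of morphisms of $P$, where $[x]=[y]$ iff there are morphisms $z_1=x,z_2,\dots,z_n=y$ of $P$ and decompositions $z_i=z_{i,t_i}^+\circ\cdots\circ z_{i,1}^+$ for $1\le i\le n-1$ and $z_i=z_{i,t_{i-1}}^-\circ\cdots\circ z_{i,1}^-$ for $2\le i\le n$ such that $Gz_{i,j}^+=Gz_{i+1,j}^-$ for all $1\le i\le n-1$, $1\le j\le t_i$. Composition is induced from $P$ by choosing composable representatives. $P/G$ is an acyclic category, in general not a poset. A trisp (triangulated space, $\Delta$-complex, semisimplicial set) consists of sets of $n$-simplices, $n\ge0$, with boundary maps $\partial_i$,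 $0\le i\le n$, satisfying $\partial_i\partial_j=\partial_{j-1}\partial_i$ for $i<j$; each $n$-simplex has an ordered list of vertices $v_0,\dots,v_n$. It is regular if these are always distinct. The nerve $\Delta(C)$ of an acyclic category $C$ is the (regular) trisp whose vertices are the objects of $C$ and whose $t$-simplices are chains $a_0\stackrel{m_1}{\rightarrow}a_1\rightarrow\cdots\stackrel{m_t}{\rightarrow}a_t$ of $t$ composable non-identity morphisms; $\partial_0$ and $\partial_t$ delete $a_0$, respectively $a_t$, and $\partial_i$ for $0<i<t$ deletes $a_i$ and composes $m_{i+1}\circ m_i$. A trisp closure map on a regular trisp $T$ is a partition of the vertex set into blue vertices $B$ and red vertices $R$, together with a map $\phi:B\to R$ such that for every simplex $\sigma$ of $T$ containing at least one blue vertex, with $b$ its minimal blue vertex (with respect to the vertex order of $\sigma$), one of the following holds: either $\phi(b)$ is a vertex of $\sigma$, and removing $\phi(b)$ from $\sigma$ yields another (unique) simplex of $T$; or $\phi(b)$ is not a vertex of $\sigma$, and there exists a unique simplex $\tau$ of $T$ that contains $\phi(b)$ as a vertex and $\sigma$ as a boundary simplex of codimension $1$. *)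

theory Defs
  imports "HOL-Algebra.Group_Action"
begin

section \<open>Posets with a group action\<close>

text \<open>A poset is a carrier \<open>P\<close> with a relation \<open>r\<close> such that
  \<open>partial_order_on P r\<close>; here \<open>(x, y) \<in> r\<close> means that \<open>x\<close> is below \<open>y\<close>.\<close>

definition order_action ::
    "('g, 'x) monoid_scheme \<Rightarrow> 'a set \<Rightarrow> ('a \<times> 'a) set \<Rightarrow> ('g \<Rightarrow> 'a \<Rightarrow> 'a) \<Rightarrow> bool" where
  "order_action G P r act \<longleftrightarrow>
     group_action G P act \<and>
     (\<forall>g\<in>carrier G. \<forall>x\<in>P. \<forall>y\<in>P. (x, y) \<in> r \<longleftrightarrow> (act g x, act g y) \<in> r)"

definition descending_closure_operator ::
    "'a set \<Rightarrow> ('a \<times> 'a) set \<Rightarrow> ('a \<Rightarrow> 'a) \<Rightarrow> bool" where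
  "descending_closure_operator P r \<phi> \<longleftrightarrow>
     \<phi> \<in> P \<rightarrow> P \<and>
     monotone_on P (\<lambda>x y. (x, y) \<in> r) (\<lambda>x y. (x, y) \<in> r) \<phi> \<and>
     (\<forall>x\<in>P. \<phi> (\<phi> x) = \<phi> x) \<and>
     (\<forall>x\<in>P. (\<phi> x, x) \<in> r)"

definition equivariant ::
    "('g, 'x) monoid_scheme \<Rightarrow> 'a set \<Rightarrow> ('g \<Rightarrow> 'a \<Rightarrow> 'a) \<Rightarrow> ('a \<Rightarrow> 'a) \<Rightarrow> bool" where
  "equivariant G P act \<phi> \<longleftrightarrow> (\<forall>g\<in>carrier G. \<forall>x\<in>P. \<phi> (act g x) = act g (\<phi> x))"


section \<open>Small categories and the quotient of a poset\<close>

text \<open>\<open>Cmp C n m\<close> is the composite of \<open>m\<close> followed by \<open>n\<close>.\<close>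

record ('o, 'm) small_category =
  Obj :: "'o set"
  Mor :: "'m set"
  Dom :: "'m \<Rightarrow> 'o"
  Cod :: "'m \<Rightarrow> 'o"
  Idn :: "'o \<Rightarrow> 'm"
  Cmp :: "'m \<Rightarrow> 'm \<Rightarrow> 'm"

text \<open>The poset as a category: the morphism from \<open>a\<close> to \<open>b\<close> is the pair \<open>(a, b) \<in> r\<close>, the
  composite of \<open>(a, b)\<close> followed by \<open>(b, c)\<close> is \<open>(a, c)\<close>, and the group acts on morphisms
  componentwise. A decomposition of \<open>z\<close> is listed in the order in which its factors are
  traversed, has at least one factor, and may contain identities.\<close>

definition decomposition :: "('a \<times> 'a) set \<Rightarrow> 'a \<times> 'a \<Rightarrow> ('a \<times> 'a) list \<Rightarrow> bool" where
  "decomposition r z zs \<longleftrightarrow>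
     zs \<noteq> [] \<and> set zs \<subseteq> r \<and> successively (\<lambda>u v. snd u = fst v) zs \<and>
     z = (fst (hd zs), snd (last zs))"

definition mor_orbit ::
    "('g, 'x) monoid_scheme \<Rightarrow> ('g \<Rightarrow> 'a \<Rightarrow> 'a) \<Rightarrow> 'a \<times> 'a \<Rightarrow> ('a \<times> 'a) set" where
  "mor_orbit G act = orbit G (\<lambda>g. map_prod (act g) (act g))"

definition mor_step ::
    "('g, 'x) monoid_scheme \<Rightarrow> ('a \<times> 'a) set \<Rightarrow> ('g \<Rightarrow> 'a \<Rightarrow> 'a) \<Rightarrow> (('a \<times> 'a) \<times> ('a \<times> 'a)) set" where
  "mor_step G r act =
     {(z, z'). \<exists>zs zs'. decomposition r z zs \<and> decomposition r z' zs' \<and>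
        list_all2 (\<lambda>u v. mor_orbit G act u = mor_orbit G act v) zs zs'}"

definition mor_class ::
    "('g, 'x) monoid_scheme \<Rightarrow> ('a \<times> 'a) set \<Rightarrow> ('g \<Rightarrow> 'a \<Rightarrow> 'a) \<Rightarrow> 'a \<times> 'a \<Rightarrow> ('a \<times> 'a) set" where
  "mor_class G r act z = (mor_step G r act)\<^sup>* `` {z}"

text \<open>All structure maps of the quotient are defined by choosing representatives; the lemmas
  below show that for a poset action the result does not depend on the choice.\<close>

definition quotient_category ::
    "('g, 'x) monoid_scheme \<Rightarrow> 'a set \<Rightarrow> ('a \<times> 'a) set \<Rightarrow> ('g \<Rightarrow> 'a \<Rightarrow> 'a)
      \<Rightarrow> ('a set, ('a \<times> 'a) set) small_category" where
  "quotient_category G P r act =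
     \<lparr> Obj = orbits G P act,
       Mor = mor_class G r act ` r,
       Dom = (\<lambda>m. the_elem {orbit G act a | a b. (a, b) \<in> m}),
       Cod = (\<lambda>m. the_elem {orbit G act b | a b. (a, b) \<in> m}),
       Idn = (\<lambda>X. the_elem {mor_class G r act (a, a) | a. a \<in> X}),
       Cmp = (\<lambda>n m. the_elem {mor_class G r act (a, c) | a b c. (a, b) \<in> m \<and> (b, c) \<in> n}) \<rparr>"


section \<open>Trisps\<close>

text \<open>\<open>face T n i\<close> is the boundary map \<open>\<partial>\<^sub>i\<close> on \<open>n\<close>-simplices, meaningful for
  \<open>n \<ge> 1\<close> and \<open>i \<le> n\<close>. Simplices of different dimension need not be
  distinguishable as elements of \<open>'s\<close>; the dimension is always carried along.\<close>

record 's trisp =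
  simplices :: "nat \<Rightarrow> 's set"
  face :: "nat \<Rightarrow> nat \<Rightarrow> 's \<Rightarrow> 's"

definition is_trisp :: "'s trisp \<Rightarrow> bool" where
  "is_trisp T \<longleftrightarrow>
     (\<forall>n. \<forall>i\<le>Suc n. face T (Suc n) i \<in> simplices T (Suc n) \<rightarrow> simplices T n) \<and>
     (\<forall>n. \<forall>\<sigma>\<in>simplices T (Suc (Suc n)). \<forall>j\<le>Suc (Suc n). \<forall>i<j.
        face T (Suc n) i (face T (Suc (Suc n)) j \<sigma>) =
        face T (Suc n) (j - 1) (face T (Suc (Suc n)) i \<sigma>))"

text \<open>\<open>nth_vertex T n i \<sigma>\<close> is the vertex \<open>v\<^sub>i\<close> of the \<open>n\<close>-simplex \<open>\<sigma>\<close>: all other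
  vertices are removed, first the last one as long as it is not \<open>v\<^sub>i\<close>, then the
  initial ones.\<close>

fun nth_vertex :: "'s trisp \<Rightarrow> nat \<Rightarrow> nat \<Rightarrow> 's \<Rightarrow> 's" where
  "nth_vertex T 0 i \<sigma> = \<sigma>"
| "nth_vertex T (Suc n) i \<sigma> =
     (if i \<le> n then nth_vertex T n i (face T (Suc n) (Suc n) \<sigma>)
      else nth_vertex T n n (face T (Suc n) 0 \<sigma>))"

definition is_regular_trisp :: "'s trisp \<Rightarrow> bool" where
  "is_regular_trisp T \<longleftrightarrow>
     is_trisp T \<and> (\<forall>n. \<forall>\<sigma>\<in>simplices T n. inj_on (\<lambda>i. nth_vertex T n i \<sigma>) {..n})"

definition vertices_of :: "'s trisp \<Rightarrow> nat \<Rightarrow> 's \<Rightarrow> 's set" where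
  "vertices_of T n \<sigma> = (\<lambda>i. nth_vertex T n i \<sigma>) ` {..n}"

definition min_blue_vertex :: "'s trisp \<Rightarrow> 's set \<Rightarrow> nat \<Rightarrow> 's \<Rightarrow> 's" where
  "min_blue_vertex T B n \<sigma> = nth_vertex T n (LEAST i. i \<le> n \<and> nth_vertex T n i \<sigma> \<in> B) \<sigma>"

definition removable :: "'s trisp \<Rightarrow> nat \<Rightarrow> 's \<Rightarrow> 's \<Rightarrow> bool" where
  "removable T n \<sigma> v \<longleftrightarrow>
     (\<exists>m. n = Suc m \<and>
       (\<exists>!\<tau>. \<tau> \<in> simplices T m \<and> (\<exists>i\<le>n. nth_vertex T n i \<sigma> = v \<and> face T n i \<sigma> = \<tau>)))"

definition uniquely_insertable :: "'s trisp \<Rightarrow> nat \<Rightarrow> 's \<Rightarrow> 's \<Rightarrow> bool" where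
  "uniquely_insertable T n \<sigma> v \<longleftrightarrow>
     (\<exists>!\<tau>. \<tau> \<in> simplices T (Suc n) \<and> v \<in> vertices_of T (Suc n) \<tau> \<and>
           (\<exists>i\<le>Suc n. face T (Suc n) i \<tau> = \<sigma>))"

definition trisp_closure_map :: "'s trisp \<Rightarrow> 's set \<Rightarrow> 's set \<Rightarrow> ('s \<Rightarrow> 's) \<Rightarrow> bool" where
  "trisp_closure_map T B R f \<longleftrightarrow>
     is_regular_trisp T \<and>
     B \<union> R = simplices T 0 \<and> B \<inter> R = {} \<and> f \<in> B \<rightarrow> R \<and>
     (\<forall>n. \<forall>\<sigma>\<in>simplices T n. vertices_of T n \<sigma> \<inter> B \<noteq> {} \<longrightarrow>
       (let v = f (min_blue_vertex T B n \<sigma>) in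
          v \<in> vertices_of T n \<sigma> \<and> removable T n \<sigma> v \<or>
          v \<notin> vertices_of T n \<sigma> \<and> uniquely_insertable T n \<sigma> v))"


section \<open>The nerve\<close>

text \<open>The chain \<open>a\<^sub>0 \<rightarrow> \<dots> \<rightarrow> a\<^sub>t\<close> with morphisms \<open>m\<^sub>1, \<dots>, m\<^sub>t\<close>
  is the pair of lists \<open>([a\<^sub>0, \<dots>, a\<^sub>t], [m\<^sub>1, \<dots>, m\<^sub>t])\<close>. As lists are indexed from
  0, the morphism \<open>m\<^sub>i\<close> is \<open>ms ! (i - 1)\<close>.\<close>

definition nerve_simplices :: "('o, 'm) small_category \<Rightarrow> nat \<Rightarrow> ('o list \<times> 'm list) set" where
  "nerve_simplices C t =
     {(as, ms). length as = Suc t \<and> length ms = t \<and> set as \<subseteq> Obj C \<and> set ms \<subseteq> Mor C \<and>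
        (\<forall>i<t. Dom C (ms ! i) = as ! i \<and> Cod C (ms ! i) = as ! Suc i \<and>
               ms ! i \<noteq> Idn C (as ! i))}"

definition nerve_face ::
    "('o, 'm) small_category \<Rightarrow> nat \<Rightarrow> nat \<Rightarrow> 'o list \<times> 'm list \<Rightarrow> 'o list \<times> 'm list" where
  "nerve_face C t i = (\<lambda>(as, ms).
     if i = 0 then (tl as, tl ms)
     else if i = t then (butlast as, butlast ms)
     else (take i as @ drop (Suc i) as,
           take (i - 1) ms @ [Cmp C (ms ! i) (ms ! (i - 1))] @ drop (Suc i) ms))"

definition nerve :: "('o, 'm) small_category \<Rightarrow> ('o list \<times> 'm list) trisp" where
  "nerve C = \<lparr> simplices = nerve_simplices C, face = nerve_face C \<rparr>"

text \<open>An object, seen as a vertex of the nerve.\<close>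

definition nerve_vertex :: "'o \<Rightarrow> 'o list \<times> 'm list" where
  "nerve_vertex a = ([a], [])"


section \<open>The colouring and the map induced by a closure operator\<close>

type_synonym 'a quotient_simplex = "'a set list \<times> ('a \<times> 'a) set list"

definition orbit_vertex ::
    "('g, 'x) monoid_scheme \<Rightarrow> ('g \<Rightarrow> 'a \<Rightarrow> 'a) \<Rightarrow> 'a \<Rightarrow> 'a quotient_simplex" where
  "orbit_vertex G act p = nerve_vertex (orbit G act p)"

definition red_vertices ::
    "('g, 'x) monoid_scheme \<Rightarrow> 'a set \<Rightarrow> ('g \<Rightarrow> 'a \<Rightarrow> 'a) \<Rightarrow> ('a \<Rightarrow> 'a)
      \<Rightarrow> 'a quotient_simplex set" where
  "red_vertices G P act \<phi> = {orbit_vertex G act (\<phi> p) | p. p \<in> P}"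

definition induced_map ::
    "('g, 'x) monoid_scheme \<Rightarrow> 'a set \<Rightarrow> ('g \<Rightarrow> 'a \<Rightarrow> 'a) \<Rightarrow> ('a \<Rightarrow> 'a)
      \<Rightarrow> 'a quotient_simplex \<Rightarrow> 'a quotient_simplex" where
  "induced_map G P act \<phi> v =
     the_elem {orbit_vertex G act (\<phi> b) | b. b \<in> P \<and> orbit_vertex G act b = v}"


section \<open>Independence of representatives\<close>

lemma the_elem_unique:
  assumes "x \<in> S" and "\<And>y. y \<in> S \<Longrightarrow> y = x"
  shows "the_elem S = x"
proof -
  have "S = {x}" using assms by blast
  then show ?thesis by simp
qed

locale poset_action =
  fixes G :: "('g, 'x) monoid_scheme" and P :: "'a set" and r :: "('a \<times> 'a) set"
    and act :: "'g \<Rightarrow> 'a \<Rightarrow> 'a"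
  assumes po: "partial_order_on P r"
    and oa: "order_action G P r act"
begin

sublocale group_action G P act
  using oa by (simp add: order_action_def)

lemma grp: "group G"
  using group_hom group_hom.axioms(1) by blast

lemma rP: "(a, b) \<in> r \<Longrightarrow> a \<in> P \<and> b \<in> P"
  using po by (auto simp: partial_order_on_def preorder_on_def)

lemma r_refl: "a \<in> P \<Longrightarrow> (a, a) \<in> r"
  using po by (auto simp: partial_order_on_def preorder_on_def refl_on_def)

lemma r_trans: "(a, b) \<in> r \<Longrightarrow> (b, c) \<in> r \<Longrightarrow> (a, c) \<in> r"
  using po by (auto simp: partial_order_on_def preorder_on_def dest: transD)

lemma act_r: "g \<in> carrier G \<Longrightarrow> (a, b) \<in> r \<Longrightarrow> (act g a, act g b) \<in> r"
  using oa rP unfolding order_action_def by blast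

lemma orbit_eqI:
  assumes g: "g \<in> carrier G" and a: "a \<in> P"
  shows "orbit G act (act g a) = orbit G act a"
proof -
  interpret group G by (rule grp)
  have 1: "act h (act g a) = act (h \<otimes>\<^bsub>G\<^esub> g) a" if "h \<in> carrier G" for h
    using composition_rule a g that by simp
  have 2: "act h a = act (h \<otimes>\<^bsub>G\<^esub> inv\<^bsub>G\<^esub> g) (act g a)" if h: "h \<in> carrier G" for h
  proof -
    have "act (h \<otimes>\<^bsub>G\<^esub> inv\<^bsub>G\<^esub> g) (act g a) = act ((h \<otimes>\<^bsub>G\<^esub> inv\<^bsub>G\<^esub> g) \<otimes>\<^bsub>G\<^esub> g) a"
      by (rule composition_rule[symmetric]) (use a g h in auto)
    then show ?thesis using g h by (simp add: m_assoc)
  qed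
  have "(\<exists>h. z = act h (act g a) \<and> h \<in> carrier G) \<longleftrightarrow>
        (\<exists>h. z = act h a \<and> h \<in> carrier G)" for z
    using 1 2 g by (metis inv_closed m_closed)
  then show ?thesis by (simp add: orbit_def)
qed

lemma mor_orbit_eqI:
  assumes g: "g \<in> carrier G" and ab: "a \<in> P" "b \<in> P"
  shows "mor_orbit G act (act g a, act g b) = mor_orbit G act (a, b)"
proof -
  interpret group G by (rule grp)
  have 1: "act h (act g x) = act (h \<otimes>\<^bsub>G\<^esub> g) x" if "h \<in> carrier G" "x \<in> P" for h x
    using composition_rule g that by simp
  have 2: "act h x = act (h \<otimes>\<^bsub>G\<^esub> inv\<^bsub>G\<^esub> g) (act g x)"
    if h: "h \<in> carrier G" and x: "x \<in> P" for h x
  proof -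
    have "act (h \<otimes>\<^bsub>G\<^esub> inv\<^bsub>G\<^esub> g) (act g x) = act ((h \<otimes>\<^bsub>G\<^esub> inv\<^bsub>G\<^esub> g) \<otimes>\<^bsub>G\<^esub> g) x"
      by (rule composition_rule[symmetric]) (use x g h in auto)
    then show ?thesis using g h by (simp add: m_assoc)
  qed
  have "(\<exists>h. z = (act h (act g a), act h (act g b)) \<and> h \<in> carrier G) \<longleftrightarrow>
        (\<exists>h. z = (act h a, act h b) \<and> h \<in> carrier G)" for z
    using 1 2 g ab by (metis inv_closed m_closed)
  then show ?thesis by (simp add: mor_orbit_def orbit_def)
qed

lemma mor_orbit_eqD:
  assumes eq: "mor_orbit G act (a, b) = mor_orbit G act (c, d)" and P: "c \<in> P" "d \<in> P"
  shows "\<exists>g\<in>carrier G. c = act g a \<and> d = act g b"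
proof -
  have "act \<one>\<^bsub>G\<^esub> c = c" "act \<one>\<^bsub>G\<^esub> d = d"
    using P id_eq_one by (metis restrict_apply')+
  moreover have "\<one>\<^bsub>G\<^esub> \<in> carrier G" using grp by (simp add: group.is_monoid)
  ultimately have "(c, d) \<in> mor_orbit G act (c, d)"
    unfolding mor_orbit_def orbit_def by force
  then have "(c, d) \<in> mor_orbit G act (a, b)" using eq by simp
  then show ?thesis unfolding mor_orbit_def orbit_def by auto
qed

lemma decomposition_in_r:
  assumes "decomposition r z zs"
  shows "z \<in> r"
proof -
  have "zs \<noteq> [] \<Longrightarrow> set zs \<subseteq> r \<Longrightarrow> successively (\<lambda>u v. snd u = fst v) zs
      \<Longrightarrow> (fst (hd zs), snd (last zs)) \<in> r" for zs
  proof (induction zs)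
    case (Cons u zs)
    then show ?case
    proof (cases zs)
      case (Cons v ws)
      have "(fst u, snd u) \<in> r" using Cons.prems by simp
      moreover have "(snd u, snd (last zs)) \<in> r" using Cons Cons.IH Cons.prems by auto
      ultimately have "(fst u, snd (last zs)) \<in> r" by (rule r_trans)
      then show ?thesis using Cons by simp
    qed auto
  qed simp
  then show ?thesis using assms by (auto simp: decomposition_def)
qed

lemma decomposition_snoc:
  "decomposition r (a, b) zs \<Longrightarrow> (b, c) \<in> r \<Longrightarrow> decomposition r (a, c) (zs @ [(b, c)])"
  by (auto simp: decomposition_def successively_append_iff)

lemma decomposition_Cons:
  "decomposition r (b, c) zs \<Longrightarrow> (a, b) \<in> r \<Longrightarrow> decomposition r (a, c) ((a, b) # zs)"
  by (cases zs) (auto simp: decomposition_def)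

lemma mor_step_sym: "(z, w) \<in> mor_step G r act \<Longrightarrow> (w, z) \<in> mor_step G r act"
proof -
  assume "(z, w) \<in> mor_step G r act"
  then obtain zs ws where "decomposition r z zs" "decomposition r w ws"
      "list_all2 (\<lambda>u v. mor_orbit G act u = mor_orbit G act v) zs ws"
    by (auto simp: mor_step_def)
  moreover from this(3)
  have "list_all2 (\<lambda>u v. mor_orbit G act u = mor_orbit G act v) ws zs"
    by (subst list_all2_conv_all_nth) (auto simp: list_all2_conv_all_nth)
  ultimately show ?thesis unfolding mor_step_def by blast
qed

lemma mor_class_eq_iff:
  "mor_class G r act z = mor_class G r act w \<longleftrightarrow> (z, w) \<in> (mor_step G r act)\<^sup>*"
proof -
  have "sym ((mor_step G r act)\<^sup>*)"
    by (rule sym_rtrancl) (blast intro: symI mor_step_sym)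
  then show ?thesis
    unfolding mor_class_def by (auto dest: symD rtrancl_trans)
qed

lemma mor_step_ends:
  assumes "((a, b), (c, d)) \<in> mor_step G r act"
  shows "(a, b) \<in> r" "(c, d) \<in> r"
    "\<exists>g\<in>carrier G. c = act g a" "\<exists>g\<in>carrier G. d = act g b"
proof -
  obtain zs ws where d: "decomposition r (a, b) zs" "decomposition r (c, d) ws"
    and l: "list_all2 (\<lambda>u v. mor_orbit G act u = mor_orbit G act v) zs ws"
    using assms by (auto simp: mor_step_def)
  show "(a, b) \<in> r" "(c, d) \<in> r" using d by (auto dest: decomposition_in_r)
  have ne: "zs \<noteq> []" "ws \<noteq> []" "set ws \<subseteq> r" using d by (auto simp: decomposition_def)
  then have inr: "hd ws \<in> r" "last ws \<in> r" by auto
  have len: "length zs = length ws" using l by (simp add: list_all2_lengthD)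
  have nth: "mor_orbit G act (zs ! i) = mor_orbit G act (ws ! i)" if "i < length zs" for i
    using list_all2_nthD[OF l that] .
  have "mor_orbit G act (hd zs) = mor_orbit G act (hd ws)"
    using nth[of 0] ne len by (simp add: hd_conv_nth)
  then have "\<exists>g\<in>carrier G. fst (hd ws) = act g (fst (hd zs))"
    using mor_orbit_eqD[of "fst (hd zs)" "snd (hd zs)" "fst (hd ws)" "snd (hd ws)"]
      rP[of "fst (hd ws)" "snd (hd ws)"] inr by auto
  then show "\<exists>g\<in>carrier G. c = act g a" using d by (auto simp: decomposition_def)
  have "mor_orbit G act (last zs) = mor_orbit G act (last ws)"
    using nth[of "length zs - 1"] ne len by (simp add: last_conv_nth)
  then have "\<exists>g\<in>carrier G. snd (last ws) = act g (snd (last zs))"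
    using mor_orbit_eqD[of "fst (last zs)" "snd (last zs)" "fst (last ws)" "snd (last ws)"]
      rP[of "fst (last ws)" "snd (last ws)"] inr by auto
  then show "\<exists>g\<in>carrier G. d = act g b" using d by (auto simp: decomposition_def)
qed

lemma mor_class_ends:
  assumes "z \<in> r" "w \<in> mor_class G r act z"
  shows "w \<in> r \<and> orbit G act (fst w) = orbit G act (fst z)
               \<and> orbit G act (snd w) = orbit G act (snd z)"
proof -
  have "(z, w) \<in> (mor_step G r act)\<^sup>*" using assms(2) by (simp add: mor_class_def)
  then show ?thesis
  proof (induction rule: rtrancl_induct)
    case base
    then show ?case using assms(1) by simp
  next
    case (step y w)
    obtain a b c d where yw: "y = (a, b)" "w = (c, d)" by (cases y, cases w) auto
    note e = mor_step_ends[OF step.hyps(2)[unfolded yw]]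
    obtain g h where "g \<in> carrier G" "c = act g a" "h \<in> carrier G" "d = act h b"
      using e by blast
    then have "orbit G act c = orbit G act a" "orbit G act d = orbit G act b"
      using rP[OF e(1)] orbit_eqI by blast+
    then show ?case using step.IH e(2) by (simp add: yw)
  qed
qed

lemma mor_step_snoc:
  assumes s: "((a, b), (a', b')) \<in> mor_step G r act" and bc: "(b, c) \<in> r"
  shows "\<exists>g\<in>carrier G. b' = act g b \<and> ((a, c), (a', act g c)) \<in> mor_step G r act"
proof -
  obtain zs ws where d: "decomposition r (a, b) zs" "decomposition r (a', b') ws"
    and l: "list_all2 (\<lambda>u v. mor_orbit G act u = mor_orbit G act v) zs ws"
    using s by (auto simp: mor_step_def)
  obtain g where g: "g \<in> carrier G" "b' = act g b" using mor_step_ends(4)[OF s] by blast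
  have "decomposition r (a, c) (zs @ [(b, c)])"
       "decomposition r (a', act g c) (ws @ [(b', act g c)])"
    using decomposition_snoc[OF d(1) bc] decomposition_snoc[OF d(2)] act_r[OF g(1) bc] g(2) by auto
  moreover have "mor_orbit G act (b, c) = mor_orbit G act (b', act g c)"
    using mor_orbit_eqI g rP[OF bc] by simp
  then have "list_all2 (\<lambda>u v. mor_orbit G act u = mor_orbit G act v)
      (zs @ [(b, c)]) (ws @ [(b', act g c)])"
    using l by (simp add: list_all2_appendI)
  ultimately show ?thesis using g unfolding mor_step_def by blast
qed

lemma mor_step_Cons:
  assumes s: "((b, c), (b', c')) \<in> mor_step G r act" and ab: "(a, b) \<in> r"
  shows "\<exists>g\<in>carrier G. b' = act g b \<and> ((a, c), (act g a, c')) \<in> mor_step G r act"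
proof -
  obtain zs ws where d: "decomposition r (b, c) zs" "decomposition r (b', c') ws"
    and l: "list_all2 (\<lambda>u v. mor_orbit G act u = mor_orbit G act v) zs ws"
    using s by (auto simp: mor_step_def)
  obtain g where g: "g \<in> carrier G" "b' = act g b" using mor_step_ends(3)[OF s] by blast
  have ab': "(act g a, b') \<in> r" using act_r[OF g(1) ab] g(2) by simp
  have "decomposition r (a, c) ((a, b) # zs)"
       "decomposition r (act g a, c') ((act g a, b') # ws)"
    using decomposition_Cons[OF d(1) ab] decomposition_Cons[OF d(2) ab'] by auto
  moreover have "mor_orbit G act (a, b) = mor_orbit G act (act g a, b')"
    using mor_orbit_eqI g rP[OF ab] by simp
  then have "list_all2 (\<lambda>u v. mor_orbit G act u = mor_orbit G act v)
      ((a, b) # zs) ((act g a, b') # ws)"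
    using l by simp
  ultimately have "((a, c), (act g a, c')) \<in> mor_step G r act"
    unfolding mor_step_def by blast
  then show ?thesis using g by blast
qed

lemma mor_step_orbit:
  assumes "g \<in> carrier G" "(a, b) \<in> r"
  shows "((a, b), (act g a, act g b)) \<in> mor_step G r act"
proof -
  have "decomposition r (a, b) [(a, b)]"
       "decomposition r (act g a, act g b) [(act g a, act g b)]"
    using assms act_r by (auto simp: decomposition_def)
  then show ?thesis unfolding mor_step_def
    using mor_orbit_eqI assms rP[OF assms(2)] by force
qed

lemma compose_move_first:
  assumes "((a, b), (a', b')) \<in> (mor_step G r act)\<^sup>*" "(b, c) \<in> r"
  shows "\<exists>c'. ((b, c), (b', c')) \<in> (mor_step G r act)\<^sup>* \<and>
              ((a, c), (a', c')) \<in> (mor_step G r act)\<^sup>* \<and> (b', c') \<in> r"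
  using assms(1)
proof (induction rule: rtrancl_induct2)
  case refl
  then show ?case using assms(2) by blast
next
  case (step a1 b1 a2 b2)
  then obtain c1 where c1: "((b, c), (b1, c1)) \<in> (mor_step G r act)\<^sup>*"
    "((a, c), (a1, c1)) \<in> (mor_step G r act)\<^sup>*" "(b1, c1) \<in> r" by blast
  obtain g where g: "g \<in> carrier G" "b2 = act g b1"
    "((a1, c1), (a2, act g c1)) \<in> mor_step G r act"
    using mor_step_snoc[OF step.hyps(2) c1(3)] by blast
  have "((b1, c1), (b2, act g c1)) \<in> mor_step G r act" "(b2, act g c1) \<in> r"
    using mor_step_orbit[OF g(1) c1(3)] act_r[OF g(1) c1(3)] g(2) by auto
  then show ?case using c1 g(3) by (meson rtrancl.rtrancl_into_rtrancl)
qed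

lemma compose_move_second:
  assumes "((b, c), (b', c')) \<in> (mor_step G r act)\<^sup>*" "(a, b) \<in> r"
  shows "\<exists>g\<in>carrier G. b' = act g b \<and> ((a, c), (act g a, c')) \<in> (mor_step G r act)\<^sup>*"
  using assms(1)
proof (induction rule: rtrancl_induct2)
  case refl
  have "act \<one>\<^bsub>G\<^esub> x = x" if "x \<in> P" for x
    using that id_eq_one by (metis restrict_apply')
  then have "act \<one>\<^bsub>G\<^esub> a = a" "act \<one>\<^bsub>G\<^esub> b = b" using rP[OF assms(2)] by auto
  moreover have "\<one>\<^bsub>G\<^esub> \<in> carrier G" using grp by (simp add: group.is_monoid)
  ultimately show ?case by (intro bexI[of _ "\<one>\<^bsub>G\<^esub>"]) auto
next
  case (step b1 c1 b2 c2)
  then obtain g where g: "g \<in> carrier G" "b1 = act g b"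
    "((a, c), (act g a, c1)) \<in> (mor_step G r act)\<^sup>*" by blast
  have "(act g a, b1) \<in> r" using act_r g assms(2) by simp
  from mor_step_Cons[OF step.hyps(2) this] obtain h where
    h: "h \<in> carrier G" "b2 = act h b1" "((act g a, c1), (act h (act g a), c2)) \<in> mor_step G r act"
    by blast
  interpret group G by (rule grp)
  have "act h (act g x) = act (h \<otimes>\<^bsub>G\<^esub> g) x" if "x \<in> P" for x
    using composition_rule g h that by simp
  then show ?case using g h rP[OF assms(2)]
    by (metis m_closed rtrancl.rtrancl_into_rtrancl)
qed

lemma compose_well_defined:
  assumes "(a, b) \<in> r" "(b, c) \<in> r" "(a', b') \<in> mor_class G r act (a, b)"
    "(b', c') \<in> mor_class G r act (b, c)"
  shows "mor_class G r act (a', c') = mor_class G r act (a, c)"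
proof -
  have s1: "((a, b), (a', b')) \<in> (mor_step G r act)\<^sup>*"
    and s2: "((b, c), (b', c')) \<in> (mor_step G r act)\<^sup>*"
    using assms by (auto simp: mor_class_def)
  have ab': "(a', b') \<in> r" using mor_class_ends assms by blast
  obtain c'' where c'': "((b, c), (b', c'')) \<in> (mor_step G r act)\<^sup>*"
    "((a, c), (a', c'')) \<in> (mor_step G r act)\<^sup>*"
    using compose_move_first[OF s1 assms(2)] by blast
  have "((b', c''), (b', c')) \<in> (mor_step G r act)\<^sup>*"
    using c''(1) s2 mor_class_eq_iff by metis
  from compose_move_second[OF this ab'] obtain g where
    g: "g \<in> carrier G" "b' = act g b'" "((a', c''), (act g a', c')) \<in> (mor_step G r act)\<^sup>*"
    by blast
  have bc': "(b', c') \<in> r" using mor_class_ends assms by blast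
  have "mor_orbit G act (act g a', b') = mor_orbit G act (a', b')"
    using mor_orbit_eqI[OF g(1), of a' b'] g(2) rP[OF ab'] by simp
  moreover have "(act g a', b') \<in> r" using act_r[OF g(1) ab'] g(2) by simp
  ultimately have
    "decomposition r (act g a', c') [(act g a', b'), (b', c')]"
    "decomposition r (a', c') [(a', b'), (b', c')]"
    "list_all2 (\<lambda>u v. mor_orbit G act u = mor_orbit G act v)
       [(act g a', b'), (b', c')] [(a', b'), (b', c')]"
    using ab' bc' by (auto simp: decomposition_def)
  then have "((act g a', c'), (a', c')) \<in> mor_step G r act"
    unfolding mor_step_def by blast
  then show ?thesis using c''(2) g(3) mor_class_eq_iff by (metis r_into_rtrancl)
qed

lemma self_in_mor_class: "z \<in> mor_class G r act z"
  by (simp add: mor_class_def)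

lemma quotient_Dom:
  assumes "(a, b) \<in> r"
  shows "Dom (quotient_category G P r act) (mor_class G r act (a, b)) = orbit G act a"
  unfolding quotient_category_def small_category.simps
  by (rule the_elem_unique) (use self_in_mor_class mor_class_ends[OF assms] in force)+

lemma quotient_Cod:
  assumes "(a, b) \<in> r"
  shows "Cod (quotient_category G P r act) (mor_class G r act (a, b)) = orbit G act b"
  unfolding quotient_category_def small_category.simps
  by (rule the_elem_unique) (use self_in_mor_class mor_class_ends[OF assms] in force)+

lemma quotient_Idn:
  assumes "a \<in> P"
  shows "Idn (quotient_category G P r act) (orbit G act a) = mor_class G r act (a, a)"
  unfolding quotient_category_def small_category.simps
proof (rule the_elem_unique)
  show "mor_class G r act (a, a) \<in> {mor_class G r act (x, x) | x. x \<in> orbit G act a}"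
    using orbit_refl[OF assms] by blast
next
  fix m assume "m \<in> {mor_class G r act (x, x) | x. x \<in> orbit G act a}"
  then obtain g where "g \<in> carrier G" "m = mor_class G r act (act g a, act g a)"
    by (auto simp: orbit_def)
  then show "m = mor_class G r act (a, a)"
    using mor_step_orbit r_refl[OF assms] mor_class_eq_iff by (metis r_into_rtrancl)
qed

lemma quotient_Cmp:
  assumes "(a, b) \<in> r" "(b, c) \<in> r"
  shows "Cmp (quotient_category G P r act) (mor_class G r act (b, c)) (mor_class G r act (a, b))
    = mor_class G r act (a, c)"
  unfolding quotient_category_def small_category.simps
proof (rule the_elem_unique)
  show "mor_class G r act (a, c) \<in> {mor_class G r act (x, z) | x y z.
      (x, y) \<in> mor_class G r act (a, b) \<and> (y, z) \<in> mor_class G r act (b, c)}"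
    using self_in_mor_class by blast
next
  fix m assume "m \<in> {mor_class G r act (x, z) | x y z.
      (x, y) \<in> mor_class G r act (a, b) \<and> (y, z) \<in> mor_class G r act (b, c)}"
  then show "m = mor_class G r act (a, c)"
    using compose_well_defined[OF assms] by blast
qed

lemma induced_map_orbit_vertex:
  assumes "descending_closure_operator P r \<phi>" "equivariant G P act \<phi>" "b \<in> P"
  shows "induced_map G P act \<phi> (orbit_vertex G act b) = orbit_vertex G act (\<phi> b)"
  unfolding induced_map_def
proof (rule the_elem_unique)
  show "orbit_vertex G act (\<phi> b) \<in>
      {orbit_vertex G act (\<phi> b') | b'. b' \<in> P \<and> orbit_vertex G act b' = orbit_vertex G act b}"
    using assms(3) by blast
next
  fix v assume "v \<in>
      {orbit_vertex G act (\<phi> b') | b'. b' \<in> P \<and> orbit_vertex G act b' = orbit_vertex G act b}"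
  then obtain b' where b': "b' \<in> P" "orbit G act b' = orbit G act b"
    and v: "v = orbit_vertex G act (\<phi> b')"
    by (auto simp: orbit_vertex_def nerve_vertex_def)
  have "b' \<in> orbit G act b" using orbit_refl[OF b'(1)] b'(2) by simp
  then obtain g where "g \<in> carrier G" "b' = act g b" by (auto simp: orbit_def)
  moreover have "\<phi> b \<in> P" using assms by (auto simp: descending_closure_operator_def)
  ultimately show "v = orbit_vertex G act (\<phi> b)"
    using assms orbit_eqI by (simp add: v orbit_vertex_def equivariant_def)
qed

end

end

theory Submission
  imports Defs
begin

text \<open>
  A descending closure operator on a poset is a coreflection: an element \<open>x\<close> in the image of
  \<open>\<phi>\<close> lies below \<open>b\<close> exactly if it lies below \<open>\<phi> b\<close>. This survives the passage to the
  quotient. By equivariance \<open>\<phi>\<close> respects the equivalence of morphisms, so it induces a functor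
  on the quotient category, and the classes of the relations \<open>\<phi> b \<le> b\<close> are morphisms
  \<open>[\<phi> b] \<rightarrow> [b]\<close>. A morphism from a red object \<open>[a]\<close>, where \<open>\<phi> a = a\<close>, to
  \<open>[b]\<close> lifts to a relation \<open>a \<le> b\<close> and factors through \<open>[\<phi> b]\<close> as the class of
  \<open>a \<le> \<phi> b\<close>. The factor is unique, because the functor recovers it from the composite: it
  turns \<open>a \<le> b\<close> into \<open>a \<le> \<phi> b\<close>. Hence the red objects span a coreflective subcategory
  (\<open>coreflective_subcategory_quotient\<close>). Finiteness enters through acyclicity: an element of
  a finite poset is not strictly comparable to a translate of itself (\<open>orbit_antichain\<close>).

  The rest holds in every acyclic category with a coreflective subcategory
  (\<open>trisp_closure_map_coreflection\<close>). Let \<open>b\<close> be the first blue object of a chain, \<open>v\<close> its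
  coreflection, and suppose that \<open>v\<close> is not in the chain. Directly before \<open>b\<close> there is exactly
  one way to insert \<open>v\<close>: the morphism \<open>v \<rightarrow> b\<close> has to be the counit, and if a morphism enters
  \<open>b\<close>, its source is red, so its factorization through the counit exists and is unique. No
  other position is possible. After \<open>b\<close> the counit would close a cycle; before a red object
  \<open>x\<close> preceding \<open>b\<close>, the morphism \<open>x \<rightarrow> b\<close> would factor through \<open>v\<close> and close a cycle
  between \<open>v\<close> and \<open>x\<close> (\<open>inserted_position\<close>). If \<open>v\<close> is in the chain already, removing it
  is merely a boundary map.
\<close>

section \<open>Acyclic categories and their nerves\<close>

definition Hom :: "('o, 'm) small_category \<Rightarrow> 'o \<Rightarrow> 'o \<Rightarrow> 'm set" where
  "Hom C a b = {m \<in> Mor C. Dom C m = a \<and> Cod C m = b}"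

text \<open>The last axiom packs together that only identities are invertible and that all
  endomorphisms are identities: two opposite morphisms compose to endomorphisms, so they are mutually
  inverse and hence identities.\<close>

locale acyclic_category =
  fixes C :: "('o, 'm) small_category"
  assumes Hom_objects: "m \<in> Hom C a b \<Longrightarrow> a \<in> Obj C \<and> b \<in> Obj C"
    and Idn_Hom: "a \<in> Obj C \<Longrightarrow> Idn C a \<in> Hom C a a"
    and Cmp_Hom: "m \<in> Hom C a b \<Longrightarrow> n \<in> Hom C b c \<Longrightarrow> Cmp C n m \<in> Hom C a c"
    and Cmp_assoc: "m \<in> Hom C a b \<Longrightarrow> n \<in> Hom C b c \<Longrightarrow> k \<in> Hom C c d \<Longrightarrow>
      Cmp C (Cmp C k n) m = Cmp C k (Cmp C n m)"
    and Cmp_Idn: "m \<in> Hom C a b \<Longrightarrow> Cmp C m (Idn C a) = m"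
    and Idn_Cmp: "m \<in> Hom C a b \<Longrightarrow> Cmp C (Idn C b) m = m"
    and acyclic: "m \<in> Hom C a b \<Longrightarrow> n \<in> Hom C b a \<Longrightarrow> m = Idn C a"
begin

lemma Hom_antisym:
  assumes "m \<in> Hom C a b" "n \<in> Hom C b a"
  shows "a = b"
proof -
  have "m \<in> Hom C a a"
    using acyclic[OF assms] Idn_Hom Hom_objects[OF assms(1)] by simp
  then show ?thesis using assms(1) by (simp add: Hom_def)
qed

text \<open>The inner boundary maps of the nerve compose two morphisms; the composite must not
  degenerate.\<close>

lemma Cmp_not_Idn:
  assumes "m \<in> Hom C a b" "n \<in> Hom C b c" "m \<noteq> Idn C a"
  shows "Cmp C n m \<noteq> Idn C a"
proof
  assume "Cmp C n m = Idn C a"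
  moreover have "Cmp C n m \<in> Hom C a c" using Cmp_Hom assms by blast
  moreover have "Idn C a \<in> Hom C a a" using Idn_Hom Hom_objects[OF assms(1)] by blast
  ultimately have "c = a" by (simp add: Hom_def)
  then show False using acyclic[OF assms(1)] assms(2,3) by blast
qed

end

lemma nerve_simplices_iff:
  "(as, ms) \<in> nerve_simplices C t \<longleftrightarrow>
     length as = Suc t \<and> length ms = t \<and> (\<forall>i\<le>t. as ! i \<in> Obj C) \<and>
     (\<forall>i<t. ms ! i \<in> Hom C (as ! i) (as ! Suc i) \<and> ms ! i \<noteq> Idn C (as ! i))"
  by (auto simp: nerve_simplices_def Hom_def subset_eq all_set_conv_all_nth less_Suc_eq_le)

lemma nerve_simps [simp]:
  "simplices (nerve C) = nerve_simplices C" "face (nerve C) = nerve_face C"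
  by (simp_all add: nerve_def)

lemma nerve_face_objects:
  assumes "length as = Suc (Suc t)" "length ms = Suc t" "i \<le> Suc t"
  shows "fst (nerve_face C (Suc t) i (as, ms)) = take i as @ drop (Suc i) as"
  using assms by (auto simp: nerve_face_def drop_Suc butlast_conv_take)

text \<open>Read entry by entry, all boundary maps follow one formula: for the outer faces the index
  at which two morphisms would be composed lies outside the list. This avoids a distinction of inner
  and outer faces from here on.\<close>

lemma nerve_face_morphisms:
  assumes "length as = Suc (Suc t)" "length ms = Suc t" "i \<le> Suc t"
  shows "length (snd (nerve_face C (Suc t) i (as, ms))) = t"
    and "k < t \<Longrightarrow> snd (nerve_face C (Suc t) i (as, ms)) ! k =
      (if Suc k < i then ms ! k
       else if Suc k = i then Cmp C (ms ! i) (ms ! k)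
       else ms ! Suc k)"
proof -
  consider "i = 0" | "i = Suc t" | "0 < i" "i \<le> t" using assms(3) by linarith
  then have "length (snd (nerve_face C (Suc t) i (as, ms))) = t \<and>
    (k < t \<longrightarrow> snd (nerve_face C (Suc t) i (as, ms)) ! k =
      (if Suc k < i then ms ! k
       else if Suc k = i then Cmp C (ms ! i) (ms ! k)
       else ms ! Suc k))"
  proof cases
    case 3
    show ?thesis
      using 3 assms by (auto simp: nerve_face_def nth_append nth_Cons' not_less)
  qed (use assms in \<open>auto simp: nerve_face_def nth_tl nth_butlast\<close>)
  then show "length (snd (nerve_face C (Suc t) i (as, ms))) = t"
    and "k < t \<Longrightarrow> snd (nerve_face C (Suc t) i (as, ms)) ! k =
      (if Suc k < i then ms ! k
       else if Suc k = i then Cmp C (ms ! i) (ms ! k)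
       else ms ! Suc k)" by auto
qed

lemma nerve_faceD:
  assumes "(as, ms) \<in> nerve_simplices C (Suc t)" "i \<le> Suc t"
    and f: "nerve_face C (Suc t) i (as, ms) = (as', ms')"
  shows "length as' = Suc t" "length ms' = t"
    and "k \<le> t \<Longrightarrow> as' ! k = (if k < i then as ! k else as ! Suc k)"
    and "k < t \<Longrightarrow> ms' ! k =
      (if Suc k < i then ms ! k
       else if Suc k = i then Cmp C (ms ! i) (ms ! k)
       else ms ! Suc k)"
proof -
  have len: "length as = Suc (Suc t)" "length ms = Suc t"
    using assms(1) by (auto simp: nerve_simplices_iff)
  have as': "as' = take i as @ drop (Suc i) as"
    using nerve_face_objects[OF len assms(2), of C] f by simp
  show "length as' = Suc t" using len assms(2) by (simp add: as')
  show "as' ! k = (if k < i then as ! k else as ! Suc k)" if "k \<le> t"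
    using that len assms(2) by (auto simp: as' nth_append)
  show "length ms' = t"
    "k < t \<Longrightarrow> ms' ! k =
      (if Suc k < i then ms ! k
       else if Suc k = i then Cmp C (ms ! i) (ms ! k)
       else ms ! Suc k)"
    using nerve_face_morphisms[OF len assms(2), where C = C] f by auto
qed

context acyclic_category
begin

lemma nerve_face_closed:
  assumes \<sigma>: "\<sigma> \<in> nerve_simplices C (Suc t)" and i: "i \<le> Suc t"
  shows "nerve_face C (Suc t) i \<sigma> \<in> nerve_simplices C t"
proof -
  obtain as ms where asms: "\<sigma> = (as, ms)" by fastforce
  note s = \<sigma>[unfolded asms nerve_simplices_iff]
  obtain as' ms' where f: "nerve_face C (Suc t) i (as, ms) = (as', ms')"
    by fastforce
  note len = nerve_faceD(1,2)[OF \<sigma>[unfolded asms] i f]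
    and as' = nerve_faceD(3)[OF \<sigma>[unfolded asms] i f]
    and ms' = nerve_faceD(4)[OF \<sigma>[unfolded asms] i f]
  have "ms' ! k \<in> Hom C (as' ! k) (as' ! Suc k) \<and> ms' ! k \<noteq> Idn C (as' ! k)" if k: "k < t" for k
  proof -
    consider "Suc k < i" | "Suc k = i" | "i \<le> k" by linarith
    then show ?thesis
    proof cases
      case 2
      then have "ms ! k \<in> Hom C (as ! k) (as ! Suc k)" "ms ! k \<noteq> Idn C (as ! k)"
        "ms ! Suc k \<in> Hom C (as ! Suc k) (as ! Suc (Suc k))"
        using s k by auto
      then show ?thesis using 2 k as' ms' Cmp_Hom Cmp_not_Idn by auto
    qed (use s k as' ms' in auto)
  qed
  then show ?thesis
    using s len as' by (auto simp: asms f nerve_simplices_iff)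
qed

lemma nerve_face_face:
  assumes \<sigma>: "\<sigma> \<in> nerve_simplices C (Suc (Suc t))" and j: "j \<le> Suc (Suc t)" and ij: "i < j"
  shows "nerve_face C (Suc t) i (nerve_face C (Suc (Suc t)) j \<sigma>) =
         nerve_face C (Suc t) (j - 1) (nerve_face C (Suc (Suc t)) i \<sigma>)"
proof -
  obtain as ms where asms: "\<sigma> = (as, ms)" by fastforce
  note s = \<sigma>[unfolded asms nerve_simplices_iff]
  have i: "i \<le> Suc (Suc t)" "i \<le> Suc t" and j1: "j - 1 \<le> Suc t" using ij j by auto
  obtain aj mj where fj: "nerve_face C (Suc (Suc t)) j (as, ms) = (aj, mj)"
    by fastforce
  note lj = nerve_faceD(1,2)[OF \<sigma>[unfolded asms] j fj]
    and aj = nerve_faceD(3)[OF \<sigma>[unfolded asms] j fj]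
    and mj = nerve_faceD(4)[OF \<sigma>[unfolded asms] j fj]
  obtain ai mi where fi: "nerve_face C (Suc (Suc t)) i (as, ms) = (ai, mi)"
    by fastforce
  note li = nerve_faceD(1,2)[OF \<sigma>[unfolded asms] i(1) fi]
    and ai = nerve_faceD(3)[OF \<sigma>[unfolded asms] i(1) fi]
    and mi = nerve_faceD(4)[OF \<sigma>[unfolded asms] i(1) fi]
  have sj: "(aj, mj) \<in> nerve_simplices C (Suc t)"
    using nerve_face_closed[OF \<sigma> j] by (simp add: asms fj)
  have si: "(ai, mi) \<in> nerve_simplices C (Suc t)"
    using nerve_face_closed[OF \<sigma> i(1)] by (simp add: asms fi)
  obtain a b where fij: "nerve_face C (Suc t) i (aj, mj) = (a, b)"
    by fastforce
  note lij = nerve_faceD(1,2)[OF sj i(2) fij]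
    and a = nerve_faceD(3)[OF sj i(2) fij]
    and b = nerve_faceD(4)[OF sj i(2) fij]
  obtain a' b' where fji: "nerve_face C (Suc t) (j - 1) (ai, mi) = (a', b')"
    by fastforce
  note lji = nerve_faceD(1,2)[OF si j1 fji]
    and a' = nerve_faceD(3)[OF si j1 fji]
    and b' = nerve_faceD(4)[OF si j1 fji]
  have "a = a'"
    by (rule nth_equalityI) (use lij lji ij j a a' ai aj in \<open>auto simp: less_Suc_eq_le\<close>)
  moreover have "b ! k = b' ! k" if k: "k < t" for k
  proof (cases "Suc k = i \<and> Suc i = j")
    case True
    \<comment> \<open>Two neighbouring objects disappear, so three morphisms are composed.\<close>
    have "ms ! k \<in> Hom C (as ! k) (as ! i)" "ms ! i \<in> Hom C (as ! i) (as ! j)"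
      "ms ! j \<in> Hom C (as ! j) (as ! Suc j)"
      using s k True by auto
    note assoc = Cmp_assoc[OF this]
    have "b ! k = Cmp C (Cmp C (ms ! j) (ms ! i)) (ms ! k)"
      using True k j by (auto simp: b mj)
    moreover have "b' ! k = Cmp C (ms ! j) (Cmp C (ms ! i) (ms ! k))"
      using True k j by (auto simp: b' mi)
    ultimately show ?thesis using assoc by simp
  next
    case False
    then show ?thesis using k ij j by (auto simp: b b' mi mj)
  qed
  then have "b = b'" using lij lji by (auto intro: nth_equalityI)
  ultimately show ?thesis by (simp add: asms fi fj fij fji[simplified])
qed

lemma is_trisp_nerve: "is_trisp (nerve C)"
  by (auto simp: is_trisp_def nerve_face_closed nerve_face_face)

lemma nth_vertex_nerve:
  assumes "(as, ms) \<in> nerve_simplices C n" "i \<le> n"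
  shows "nth_vertex (nerve C) n i (as, ms) = nerve_vertex (as ! i)"
  using assms
proof (induction n arbitrary: i as ms)
  case 0
  then show ?case by (auto simp: nerve_simplices_iff nerve_vertex_def length_Suc_conv)
next
  case (Suc n)
  have len: "length as = Suc (Suc n)" using Suc.prems(1) by (simp add: nerve_simplices_iff)
  show ?case
  proof (cases "i \<le> n")
    case True
    have "(butlast as, butlast ms) \<in> nerve_simplices C n"
      using nerve_face_closed[OF Suc.prems(1), of "Suc n"] by (simp add: nerve_face_def)
    then show ?thesis
      using Suc.IH True len by (simp add: nerve_face_def nth_butlast)
  next
    case False
    have "(tl as, tl ms) \<in> nerve_simplices C n"
      using nerve_face_closed[OF Suc.prems(1), of 0] by (simp add: nerve_face_def)
    then show ?thesis
      using Suc.IH[of "tl as" "tl ms" n] Suc.prems(2) False len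
      by (simp add: nerve_face_def nth_tl le_Suc_eq)
  qed
qed

lemma vertices_of_nerve:
  assumes "(as, ms) \<in> nerve_simplices C n"
  shows "vertices_of (nerve C) n (as, ms) = nerve_vertex ` set as"
proof -
  have "vertices_of (nerve C) n (as, ms) = (\<lambda>i. nerve_vertex (as ! i)) ` {..n}"
    unfolding vertices_of_def using nth_vertex_nerve[OF assms] by (intro image_cong) auto
  also have "\<dots> = nerve_vertex ` (\<lambda>i. as ! i) ` {..<length as}"
    using assms by (simp add: image_image nerve_simplices_iff lessThan_Suc_atMost)
  also have "(\<lambda>i. as ! i) ` {..<length as} = set as" by (auto simp: set_conv_nth)
  finally show ?thesis .
qed

lemma nerve_path:
  assumes s: "(as, ms) \<in> nerve_simplices C n" and ij: "i \<le> j" "j \<le> n"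
  shows "\<exists>m. m \<in> Hom C (as ! i) (as ! j)"
  using ij
proof (induction j rule: dec_induct)
  case base
  then show ?case using s Idn_Hom by (auto simp: nerve_simplices_iff)
next
  case (step j)
  then obtain m where "m \<in> Hom C (as ! i) (as ! j)" by auto
  moreover have "ms ! j \<in> Hom C (as ! j) (as ! Suc j)"
    using s step by (auto simp: nerve_simplices_iff)
  ultimately show ?case using Cmp_Hom by blast
qed

text \<open>A repeated object would close up a cycle through a non-identity morphism.\<close>

lemma nerve_objects_distinct:
  assumes s: "(as, ms) \<in> nerve_simplices C n" and ij: "i < j" "j \<le> n"
  shows "as ! i \<noteq> as ! j"
proof
  assume eq: "as ! i = as ! j"
  have "ms ! i \<in> Hom C (as ! i) (as ! Suc i)" "ms ! i \<noteq> Idn C (as ! i)"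
    using s ij by (auto simp: nerve_simplices_iff)
  moreover obtain m where "m \<in> Hom C (as ! Suc i) (as ! j)"
    using nerve_path[OF s, of "Suc i" j] ij by auto
  ultimately show False using acyclic eq by auto
qed

lemma is_regular_trisp_nerve: "is_regular_trisp (nerve C)"
proof -
  have "inj_on (\<lambda>i. nth_vertex (nerve C) n i (as, ms)) {..n}"
    if s: "(as, ms) \<in> nerve_simplices C n" for n as ms
  proof (rule linorder_inj_onI)
    fix i j assume "i < j" "i \<in> {..n}" "j \<in> {..n}"
    then show "nth_vertex (nerve C) n i (as, ms) \<noteq> nth_vertex (nerve C) n j (as, ms)"
      using nerve_objects_distinct[OF s] nth_vertex_nerve[OF s] by (simp add: nerve_vertex_def)
  qed auto
  then show ?thesis
    using is_trisp_nerve by (auto simp: is_regular_trisp_def)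
qed


lemma nerve_vertices: "nerve_simplices C 0 = nerve_vertex ` Obj C"
  by (auto simp: nerve_simplices_def nerve_vertex_def length_Suc_conv image_iff)

lemma removable_nerve:
  assumes s: "(as, ms) \<in> nerve_simplices C (Suc n)" and i: "i \<le> Suc n"
  shows "removable (nerve C) (Suc n) (as, ms) (nerve_vertex (as ! i))"
proof -
  have unique: "j = i" if "as ! j = as ! i" "j \<le> Suc n" for j
    using that i nerve_objects_distinct[OF s] by (metis linorder_neqE_nat)
  have "(j \<le> Suc n \<and> nth_vertex (nerve C) (Suc n) j (as, ms) = nerve_vertex (as ! i) \<and>
      nerve_face C (Suc n) j (as, ms) = \<tau>) \<longleftrightarrow> j = i \<and> nerve_face C (Suc n) i (as, ms) = \<tau>" for j \<tau>
    using nth_vertex_nerve[OF s] i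
    by (auto simp: nerve_vertex_def simp del: nth_vertex.simps dest: unique)
  then show ?thesis
    using nerve_face_closed[OF s i] by (auto simp: removable_def simp del: nth_vertex.simps)
qed

text \<open>An object can be inserted before the \<open>k\<close>-th one by splitting the morphism that enters the
  latter. For \<open>k = 0\<close> no morphism enters, and there is nothing to split.\<close>

lemma nerve_insert:
  assumes s: "(as, ms) \<in> nerve_simplices C n" and k: "k \<le> n"
    and e: "e \<in> Hom C v (as ! k)" "e \<noteq> Idn C v"
    and d: "0 < k \<Longrightarrow> d \<in> Hom C (as ! (k - 1)) v \<and> d \<noteq> Idn C (as ! (k - 1)) \<and>
      Cmp C e d = ms ! (k - 1)"
  shows "\<exists>bs ls. (bs, ls) \<in> nerve_simplices C (Suc n) \<and> bs ! k = v \<and>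
    nerve_face C (Suc n) k (bs, ls) = (as, ms)"
proof -
  note s' = s[unfolded nerve_simplices_iff]
  define bs where "bs = take k as @ v # drop k as"
  define ls where "ls = take (k - 1) ms @ (if k = 0 then [e] else [d, e]) @ drop k ms"
  have len: "length bs = Suc (Suc n)" "length ls = Suc n"
    using s' k by (auto simp: bs_def ls_def)
  have bs: "bs ! p = (if p < k then as ! p else if p = k then v else as ! (p - 1))"
    if "p \<le> Suc n" for p
    using that s' k by (auto simp: bs_def nth_append nth_Cons')
  have ls: "ls ! p = (if Suc p < k then ms ! p else if Suc p = k then d else if p = k then e
      else ms ! (p - 1))" if "p \<le> n" for p
    using that s' k by (auto simp: ls_def nth_append nth_Cons')
  have v: "v \<in> Obj C" using Hom_objects[OF e(1)] by simp
  have "ls ! p \<in> Hom C (bs ! p) (bs ! Suc p) \<and> ls ! p \<noteq> Idn C (bs ! p)" if p: "p \<le> n" for p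
  proof -
    consider "Suc p < k" | "Suc p = k" | "p = k" | "k < p" by linarith
    then show ?thesis
    proof cases
      case 2
      then show ?thesis using d p by (auto simp: bs ls)
    next
      case 4
      then show ?thesis using s' p by (cases p) (auto simp: bs ls)
    qed (use s' p k e in \<open>auto simp: bs ls\<close>)
  qed
  then have "(bs, ls) \<in> nerve_simplices C (Suc n)"
    using s' v k by (auto simp: nerve_simplices_iff len bs less_Suc_eq_le)
  moreover have "bs ! k = v" using bs k by simp
  moreover have "nerve_face C (Suc n) k (bs, ls) = (as, ms)"
  proof -
    obtain as' ms' where f: "nerve_face C (Suc n) k (bs, ls) = (as', ms')"
      by fastforce
    note len' = nerve_faceD(1,2)[OF \<open>(bs, ls) \<in> _\<close> le_SucI[OF k] f]
      and as' = nerve_faceD(3)[OF \<open>(bs, ls) \<in> _\<close> le_SucI[OF k] f]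
      and ms' = nerve_faceD(4)[OF \<open>(bs, ls) \<in> _\<close> le_SucI[OF k] f]
    have "as' = as"
      by (rule nth_equalityI) (use s' len' k in \<open>auto simp: as' bs\<close>)
    moreover have "ms' = ms"
      by (rule nth_equalityI) (use s' len' k d in \<open>auto simp: ms' ls\<close>)
    ultimately show ?thesis by (simp add: f)
  qed
  ultimately show ?thesis by blast
qed

text \<open>The boundary map that deletes the \<open>k\<close>-th object forgets only this object and its two
  adjacent morphisms.\<close>

lemma nerve_face_inject:
  assumes s: "(as, ms) \<in> nerve_simplices C (Suc n)" "(bs, ls) \<in> nerve_simplices C (Suc n)"
    and k: "k \<le> n"
    and eq: "nerve_face C (Suc n) k (as, ms) = nerve_face C (Suc n) k (bs, ls)"
    and obj: "as ! k = bs ! k" and out: "ms ! k = ls ! k"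
    and inc: "0 < k \<Longrightarrow> ms ! (k - 1) = ls ! (k - 1)"
  shows "(as, ms) = (bs, ls)"
proof -
  have k': "k \<le> Suc n" using k by simp
  obtain as' ms' where f: "nerve_face C (Suc n) k (as, ms) = (as', ms')"
    by fastforce
  note as = nerve_faceD(3)[OF s(1) k' f]
    and ms = nerve_faceD(4)[OF s(1) k' f]
  obtain bs' ls' where g: "nerve_face C (Suc n) k (bs, ls) = (bs', ls')"
    by fastforce
  note bs = nerve_faceD(3)[OF s(2) k' g]
    and ls = nerve_faceD(4)[OF s(2) k' g]
  have eqs: "as' = bs'" "ms' = ls'" using eq f g by auto
  have "as ! p = bs ! p" if "p \<le> Suc n" for p
  proof -
    consider "p < k" | "p = k" | "k < p" by linarith
    then show ?thesis
    proof cases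
      case 1
      then show ?thesis using as[of p] bs[of p] eqs k by simp
    next
      case 3
      then obtain q where "p = Suc q" by (cases p) auto
      then show ?thesis using 3 as[of q] bs[of q] eqs that by simp
    qed (use obj in simp)
  qed
  moreover have "ms ! p = ls ! p" if "p \<le> n" for p
  proof -
    consider "Suc p < k" | "Suc p = k" | "p = k" | "k < p" by linarith
    then show ?thesis
    proof cases
      case 1
      then show ?thesis using ms[of p] ls[of p] eqs k by simp
    next
      case 4
      then obtain q where "p = Suc q" by (cases p) auto
      then show ?thesis using 4 ms[of q] ls[of q] eqs that by simp
    qed (use out inc in auto)
  qed
  ultimately show ?thesis
    using s by (auto simp: nerve_simplices_iff intro!: nth_equalityI)
qed

end


section \<open>Coreflective subcategories of acyclic categories\<close>

text \<open>Objects of the full subcategory on \<open>R\<close> are the red ones, \<open>f\<close> is the coreflector on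
  objects, and the universal morphism \<open>e\<close> is the counit of the adjunction.\<close>

locale coreflective_subcategory = acyclic_category C
  for C :: "('o, 'm) small_category" +
  fixes R :: "'o set" and f :: "'o \<Rightarrow> 'o"
  assumes subobjects: "R \<subseteq> Obj C"
    and coreflection_mem: "b \<in> Obj C \<Longrightarrow> f b \<in> R"
    and universal: "b \<in> Obj C \<Longrightarrow> \<exists>e\<in>Hom C (f b) b. \<forall>x\<in>R. \<forall>m\<in>Hom C x b.
      \<exists>!n. n \<in> Hom C x (f b) \<and> Cmp C e n = m"
begin

definition counit :: "'o \<Rightarrow> 'm" where
  "counit b = (SOME e. e \<in> Hom C (f b) b \<and> (\<forall>x\<in>R. \<forall>m\<in>Hom C x b.
     \<exists>!n. n \<in> Hom C x (f b) \<and> Cmp C e n = m))"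

lemma counit:
  assumes "b \<in> Obj C"
  shows counit_Hom: "counit b \<in> Hom C (f b) b"
    and counit_universal: "x \<in> R \<Longrightarrow> m \<in> Hom C x b \<Longrightarrow>
      \<exists>!n. n \<in> Hom C x (f b) \<and> Cmp C (counit b) n = m"
proof -
  have "\<exists>e. e \<in> Hom C (f b) b \<and> (\<forall>x\<in>R. \<forall>m\<in>Hom C x b.
     \<exists>!n. n \<in> Hom C x (f b) \<and> Cmp C e n = m)"
    using universal[OF assms] unfolding Bex_def .
  from someI_ex[OF this] have *: "counit b \<in> Hom C (f b) b \<and> (\<forall>x\<in>R. \<forall>m\<in>Hom C x b.
     \<exists>!n. n \<in> Hom C x (f b) \<and> Cmp C (counit b) n = m)"
    unfolding counit_def .
  from * show "counit b \<in> Hom C (f b) b" by (rule conjunct1)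
  from conjunct2[OF *] show "\<exists>!n. n \<in> Hom C x (f b) \<and> Cmp C (counit b) n = m"
    if "x \<in> R" "m \<in> Hom C x b" using that by blast
qed

text \<open>Any morphism from \<open>f b\<close> to \<open>b\<close> factors through the counit by an endomorphism of
  \<open>f b\<close>, which is an identity.\<close>

lemma counit_unique:
  assumes b: "b \<in> Obj C" and m: "m \<in> Hom C (f b) b"
  shows "m = counit b"
proof -
  obtain n where n: "n \<in> Hom C (f b) (f b)" "Cmp C (counit b) n = m"
    using counit_universal[OF b coreflection_mem[OF b] m] by (elim ex1E conjE)
  then have "n = Idn C (f b)" using acyclic by blast
  then show ?thesis using n(2) Cmp_Idn[OF counit_Hom[OF b]] by simp
qed

text \<open>If a boundary simplex does not contain \<open>f (as ! k)\<close>, then the deleted object is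
  \<open>f (as ! k)\<close>, and only its position is in question. Deleted at a later
  position, it would be reachable from \<open>as ! k\<close>, against the direction of the counit; deleted at an
  earlier position, it would precede a red object of the chain, which maps to it by universality.\<close>

lemma inserted_position:
  assumes s: "(as, ms) \<in> nerve_simplices C n" and k: "k \<le> n"
    and blue: "as ! k \<notin> R" and red: "\<And>i. i < k \<Longrightarrow> as ! i \<in> R"
    and new: "f (as ! k) \<notin> set as"
    and t: "(bs, ls) \<in> nerve_simplices C (Suc n)" and mem: "f (as ! k) \<in> set bs"
    and i: "i \<le> Suc n" and face: "nerve_face C (Suc n) i (bs, ls) = (as, ms)"
  shows "i = k \<and> bs ! k = f (as ! k)"
proof -
  let ?v = "f (as ! k)"
  have obj: "as ! k \<in> Obj C" using s k by (auto simp: nerve_simplices_iff)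
  have lens: "length as = Suc n" "length bs = Suc (Suc n)"
    using s t by (auto simp: nerve_simplices_iff)
  have as: "as ! p = (if p < i then bs ! p else bs ! Suc p)" if "p \<le> n" for p
    using that by (rule nerve_faceD(3)[OF t i face])
  note e = counit_Hom[OF obj] and u = counit_universal[OF obj]
  obtain j where j: "j \<le> Suc n" "bs ! j = ?v"
    using mem lens by (auto simp: in_set_conv_nth less_Suc_eq_le)
  have ji: "j = i"
  proof (rule ccontr)
    assume "j \<noteq> i"
    then have "\<exists>p\<le>n. as ! p = ?v"
    proof (cases "j < i")
      case True
      then show ?thesis using as[of j] i j by (intro exI[of _ j]) auto
    next
      case False
      then show ?thesis using \<open>j \<noteq> i\<close> as[of "j - 1"] j by (intro exI[of _ "j - 1"]) auto
    qed
    then show False using new lens(1) by (auto simp: in_set_conv_nth less_Suc_eq_le)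
  qed
  have "\<not> k < i"
  proof
    assume "k < i"
    then obtain m where "m \<in> Hom C (as ! k) ?v"
      using nerve_path[OF t, of k i] as[OF k] i j ji by auto
    then have "as ! k = ?v" using Hom_antisym[OF _ e] by blast
    then show False using blue coreflection_mem[OF obj] by simp
  qed
  moreover have "\<not> i < k"
  proof
    assume ik: "i < k"
    \<comment> \<open>The successor of the inserted object is red and maps to \<open>as ! k\<close>, hence maps back to the
      inserted object.\<close>
    then obtain m where m: "m \<in> Hom C ?v (as ! i)"
      using nerve_path[OF t, of i "Suc i"] as[of i] k j ji by auto
    obtain m' where "m' \<in> Hom C (as ! i) (as ! k)"
      using nerve_path[OF s, of i k] ik k by auto
    with u[OF red[OF ik]] obtain n where "n \<in> Hom C (as ! i) ?v" by blast
    then have "?v = as ! i" using Hom_antisym[OF m] by blast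
    moreover have "as ! i \<in> set as" using lens ik k by simp
    ultimately show False using new by simp
  qed
  ultimately show ?thesis using j ji by auto
qed

text \<open>Both morphisms adjacent to the inserted object are forced: the outgoing one is the counit,
  and the incoming one is the universal factor of the morphism that it splits.\<close>

lemma uniquely_insertable_coreflection:
  assumes s: "(as, ms) \<in> nerve_simplices C n" and k: "k \<le> n"
    and blue: "as ! k \<notin> R" and red: "\<And>i. i < k \<Longrightarrow> as ! i \<in> R"
    and new: "f (as ! k) \<notin> set as"
  shows "uniquely_insertable (nerve C) n (as, ms) (nerve_vertex (f (as ! k)))"
proof -
  let ?v = "f (as ! k)"
  note s' = s[unfolded nerve_simplices_iff]
  have obj: "as ! k \<in> Obj C" using s' k by auto
  let ?e = "counit (as ! k)"
  note e = counit_Hom[OF obj] and u = counit_universal[OF obj]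
    and e_unique = counit_unique[OF obj]
  have incoming: "as ! (k - 1) \<in> R" "ms ! (k - 1) \<in> Hom C (as ! (k - 1)) (as ! k)" if "0 < k"
  proof -
    have "k - 1 < n" "Suc (k - 1) = k" using that k by auto
    moreover have "\<forall>i<n. ms ! i \<in> Hom C (as ! i) (as ! Suc i)" using s' by blast
    ultimately show "ms ! (k - 1) \<in> Hom C (as ! (k - 1)) (as ! k)" by fastforce
  qed (use red that in auto)
  have e_nonid: "?e \<noteq> Idn C ?v"
  proof
    assume "?e = Idn C ?v"
    then have "?v = as ! k"
      using e Idn_Hom Hom_objects[OF e] by (auto simp: Hom_def)
    then show False using blue coreflection_mem[OF obj] by simp
  qed
  have "\<exists>bs ls. (bs, ls) \<in> nerve_simplices C (Suc n) \<and> bs ! k = ?v \<and>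
    nerve_face C (Suc n) k (bs, ls) = (as, ms)"
  proof (cases "k = 0")
    case True
    show ?thesis by (rule nerve_insert[OF s k e e_nonid]) (use True in simp)
  next
    case False
    then have k0: "0 < k" by simp
    obtain d where d: "d \<in> Hom C (as ! (k - 1)) ?v" "Cmp C ?e d = ms ! (k - 1)"
      using u[OF incoming[OF k0]] by blast
    have "d \<noteq> Idn C (as ! (k - 1))"
    proof
      assume "d = Idn C (as ! (k - 1))"
      then have "?v = as ! (k - 1)"
        using d(1) Idn_Hom Hom_objects[OF d(1)] by (auto simp: Hom_def)
      moreover have "as ! (k - 1) \<in> set as" using s' k by auto
      ultimately show False using new by simp
    qed
    then show ?thesis using nerve_insert[OF s k e e_nonid, of d] d by blast
  qed
  then obtain bs ls where t: "(bs, ls) \<in> nerve_simplices C (Suc n)" "bs ! k = ?v"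
    "nerve_face C (Suc n) k (bs, ls) = (as, ms)"
    by blast
  have vert: "nerve_vertex ?v \<in> vertices_of (nerve C) (Suc n) (bs', ls') \<longleftrightarrow> ?v \<in> set bs'"
    if "(bs', ls') \<in> nerve_simplices C (Suc n)" for bs' ls'
    using vertices_of_nerve[OF that] by (auto simp: nerve_vertex_def)
  have neighbours: "ls' ! k = ?e \<and> (0 < k \<longrightarrow>
      ls' ! (k - 1) \<in> Hom C (as ! (k - 1)) ?v \<and> Cmp C ?e (ls' ! (k - 1)) = ms ! (k - 1))"
    if t': "(bs', ls') \<in> nerve_simplices C (Suc n)" "bs' ! k = ?v"
      "nerve_face C (Suc n) k (bs', ls') = (as, ms)" for bs' ls'
  proof -
    note t'' = t'(1)[unfolded nerve_simplices_iff]
    have k': "k \<le> Suc n" using k by simp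
    have as: "as ! p = (if p < k then bs' ! p else bs' ! Suc p)" if "p \<le> n" for p
      using that by (rule nerve_faceD(3)[OF t'(1) k' t'(3)])
    have ms: "ms ! p = (if Suc p < k then ls' ! p
       else if Suc p = k then Cmp C (ls' ! k) (ls' ! p) else ls' ! Suc p)" if "p < n" for p
      using that by (rule nerve_faceD(4)[OF t'(1) k' t'(3)])
    have "ls' ! k \<in> Hom C (bs' ! k) (bs' ! Suc k)" using t'' k by simp
    then have "ls' ! k \<in> Hom C ?v (as ! k)" using as[OF k] t'(2) by simp
    then have e': "ls' ! k = ?e" by (rule e_unique)
    moreover have "ls' ! (k - 1) \<in> Hom C (as ! (k - 1)) ?v \<and>
        Cmp C ?e (ls' ! (k - 1)) = ms ! (k - 1)" if "0 < k"
    proof -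
      obtain p where p: "k = Suc p" using \<open>0 < k\<close> by (cases k) auto
      have "ls' ! p \<in> Hom C (bs' ! p) (bs' ! k)" using t'' p k by simp
      then show ?thesis using as[of p] ms[of p] t'(2) e' p k by simp
    qed
    ultimately show ?thesis by blast
  qed
  have "\<tau> = (bs, ls)" if \<tau>: "\<tau> \<in> nerve_simplices C (Suc n)"
    "nerve_vertex ?v \<in> vertices_of (nerve C) (Suc n) \<tau>"
    "\<exists>i\<le>Suc n. nerve_face C (Suc n) i \<tau> = (as, ms)" for \<tau>
  proof -
    obtain bs' ls' where eq: "\<tau> = (bs', ls')" by fastforce
    note t' = \<tau>[unfolded eq]
    obtain i where i: "i \<le> Suc n" "nerve_face C (Suc n) i (bs', ls') = (as, ms)"
      using t'(3) by blast
    have "?v \<in> set bs'" using vert t' by blast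
    note pos = inserted_position[OF s k blue red new t'(1) this i]
    then have face': "nerve_face C (Suc n) k (bs', ls') = (as, ms)" "bs' ! k = ?v"
      using i by auto
    note m = neighbours[OF t] and m' = neighbours[OF t'(1) face'(2,1)]
    have "ls' ! (k - 1) = ls ! (k - 1)" if "0 < k"
      using u[OF incoming[OF that]] m m' that by blast
    then show ?thesis
      using nerve_face_inject[OF t'(1) t(1) k] face' t m m' unfolding eq by auto
  qed
  moreover have "?v \<in> set bs"
    using t k nth_mem[of k bs] by (simp add: nerve_simplices_iff)
  then have "nerve_vertex ?v \<in> vertices_of (nerve C) (Suc n) (bs, ls)"
    using vert[OF t(1)] by simp
  ultimately show ?thesis
    unfolding uniquely_insertable_def nerve_simps
    using t(1,3) le_SucI[OF k] by (intro ex1I[of _ "(bs, ls)"]) blast+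
qed

text \<open>The chain up to its minimal blue object is a run of red objects, so the coreflection can be
  inserted in exactly one way unless it is present. In that case it differs from the blue object, so
  the simplex has positive dimension and the vertex can be removed.\<close>

theorem trisp_closure_map_coreflection:
  assumes F: "\<And>b. b \<in> Obj C - R \<Longrightarrow> F (nerve_vertex b) = nerve_vertex (f b)"
  shows "trisp_closure_map (nerve C) (simplices (nerve C) 0 - nerve_vertex ` R)
    (nerve_vertex ` R) F"
proof -
  let ?B = "nerve_simplices C 0 - nerve_vertex ` R"
  have B: "nerve_vertex b \<in> ?B \<longleftrightarrow> b \<in> Obj C - R" for b
    by (auto simp: nerve_vertices nerve_vertex_def)
  have F_red: "F \<in> ?B \<rightarrow> nerve_vertex ` R"
  proof
    fix v assume v: "v \<in> ?B"
    then obtain b where "v = nerve_vertex b" by (auto simp: nerve_vertices)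
    then show "F v \<in> nerve_vertex ` R" using F[of b] coreflection_mem[of b] v B[of b] by simp
  qed
  have match: "let v = F (min_blue_vertex (nerve C) ?B n (as, ms)) in
      v \<in> vertices_of (nerve C) n (as, ms) \<and> removable (nerve C) n (as, ms) v \<or>
      v \<notin> vertices_of (nerve C) n (as, ms) \<and> uniquely_insertable (nerve C) n (as, ms) v"
    if s: "(as, ms) \<in> nerve_simplices C n"
      and blue: "vertices_of (nerve C) n (as, ms) \<inter> ?B \<noteq> {}" for n as ms
  proof -
    note s' = s[unfolded nerve_simplices_iff]
    let ?Q = "\<lambda>i. i \<le> n \<and> nth_vertex (nerve C) n i (as, ms) \<in> ?B"
    have Q: "?Q i \<longleftrightarrow> i \<le> n \<and> as ! i \<notin> R" for i
      using nth_vertex_nerve[OF s, of i] B[of "as ! i"] s' by (cases "i \<le> n") simp_all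
    define k where "k = (LEAST i. ?Q i)"
    have "\<exists>i. ?Q i" using blue by (auto simp: vertices_of_def)
    then have "?Q k" unfolding k_def by (rule LeastI_ex)
    then have k: "k \<le> n" "as ! k \<notin> R" using Q by auto
    have red: "as ! i \<in> R" if "i < k" for i
    proof -
      have "\<not> ?Q i" using not_less_Least[of i ?Q, folded k_def] that .
      then show ?thesis using Q[of i] that k(1) by linarith
    qed
    let ?v = "f (as ! k)"
    have obj: "as ! k \<in> Obj C" using s' k by simp
    have v: "F (min_blue_vertex (nerve C) ?B n (as, ms)) = nerve_vertex ?v"
      unfolding min_blue_vertex_def k_def[symmetric]
      using F[of "as ! k"] obj k nth_vertex_nerve[OF s k(1)] by simp
    have vert: "nerve_vertex ?v \<in> vertices_of (nerve C) n (as, ms) \<longleftrightarrow> ?v \<in> set as"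
      using vertices_of_nerve[OF s] by (auto simp: nerve_vertex_def)
    show ?thesis
    proof (cases "?v \<in> set as")
      case True
      then obtain i where i: "i \<le> n" "as ! i = ?v"
        using s' by (auto simp: in_set_conv_nth less_Suc_eq_le)
      have "i \<noteq> k" using i coreflection_mem[OF obj] k by auto
      then obtain m where "n = Suc m" using i k(1) by (cases n) auto
      then show ?thesis
        using removable_nerve[of as ms m i] s i v vert True by simp
    next
      case False
      then show ?thesis
        using uniquely_insertable_coreflection[OF s k red] v vert by simp
    qed
  qed
  have "nerve_vertex ` R \<subseteq> nerve_simplices C 0"
    using subobjects by (auto simp: nerve_vertices)
  then show ?thesis
    unfolding trisp_closure_map_def nerve_simps
    using is_regular_trisp_nerve F_red
    by (intro conjI allI ballI impI) (auto simp only: split_paired_all intro: match)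
qed

end


section \<open>The quotient of a finite poset\<close>

context poset_action
begin

lemma r_antisym: "(a, b) \<in> r \<Longrightarrow> (b, a) \<in> r \<Longrightarrow> a = b"
  using po by (auto simp: partial_order_on_def dest: antisymD)

lemma orbit_eqD:
  assumes "orbit G act a = orbit G act b" "b \<in> P"
  obtains g where "g \<in> carrier G" "b = act g a"
  using assms orbit_refl[of b] by (auto simp: orbit_def)

lemma mor_class_act:
  assumes "g \<in> carrier G" "(a, b) \<in> r"
  shows "mor_class G r act (act g a, act g b) = mor_class G r act (a, b)"
  using mor_step_orbit[OF assms] mor_class_eq_iff by (metis r_into_rtrancl)

lemma mor_class_Hom:
  assumes "(a, b) \<in> r"
  shows "mor_class G r act (a, b) \<in>
    Hom (quotient_category G P r act) (orbit G act a) (orbit G act b)"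
  using assms quotient_Dom[OF assms] quotient_Cod[OF assms]
  by (simp add: Hom_def quotient_category_def)

lemma quotient_HomE:
  assumes "m \<in> Hom (quotient_category G P r act) X Y"
  obtains a b where "(a, b) \<in> r" "m = mor_class G r act (a, b)"
    "X = orbit G act a" "Y = orbit G act b"
proof -
  have "m \<in> mor_class G r act ` r"
    using assms by (simp add: Hom_def quotient_category_def)
  then obtain a b where ab: "(a, b) \<in> r" "m = mor_class G r act (a, b)" by auto
  show ?thesis
    using that[OF ab] mor_class_Hom[OF ab(1)] assms ab(2) by (simp add: Hom_def)
qed

text \<open>Morphisms of the quotient lift to the poset with a prescribed lift of either endpoint, so a
  chain in the quotient can be lifted one morphism at a time.\<close>

lemma quotient_Hom_lift_source:
  assumes "m \<in> Hom (quotient_category G P r act) (orbit G act a) Y" "a \<in> P"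
  obtains b where "(a, b) \<in> r" "m = mor_class G r act (a, b)" "Y = orbit G act b"
proof -
  obtain a' b' where m: "(a', b') \<in> r" "m = mor_class G r act (a', b')"
    "orbit G act a' = orbit G act a" "Y = orbit G act b'"
    using quotient_HomE[OF assms(1)] by metis
  obtain g where g: "g \<in> carrier G" "a = act g a'"
    using orbit_eqD[OF m(3) assms(2)] by blast
  show ?thesis
    using that[of "act g b'"] act_r[OF g(1) m(1)] mor_class_act[OF g(1) m(1)]
      orbit_eqI[OF g(1)] rP[OF m(1)] m g(2) by simp
qed

lemma quotient_Hom_lift_target:
  assumes "m \<in> Hom (quotient_category G P r act) X (orbit G act b)" "b \<in> P"
  obtains a where "(a, b) \<in> r" "m = mor_class G r act (a, b)" "X = orbit G act a"
proof -
  obtain a' b' where m: "(a', b') \<in> r" "m = mor_class G r act (a', b')"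
    "X = orbit G act a'" "orbit G act b' = orbit G act b"
    using quotient_HomE[OF assms(1)] by metis
  obtain g where g: "g \<in> carrier G" "b = act g b'"
    using orbit_eqD[OF m(4) assms(2)] by blast
  show ?thesis
    using that[of "act g a'"] act_r[OF g(1) m(1)] mor_class_act[OF g(1) m(1)]
      orbit_eqI[OF g(1)] rP[OF m(1)] m g(2) by simp
qed

text \<open>If \<open>x\<close> lies below its translate \<open>g x\<close>, the finite down-set of \<open>x\<close> is contained
  in that of \<open>g x\<close>; translation by \<open>g\<close> makes them equally large, so they coincide.\<close>

lemma orbit_antichain:
  assumes fin: "finite P" and g: "g \<in> carrier G" and le: "(x, act g x) \<in> r"
  shows "act g x = x"
proof -
  define D where "D z = {y \<in> P. (y, z) \<in> r}" for z
  have x: "x \<in> P" "act g x \<in> P" using rP[OF le] by auto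
  have sub: "D x \<subseteq> D (act g x)" using r_trans le by (auto simp: D_def)
  have "D (act g x) \<subseteq> act g ` D x"
  proof
    fix y assume y: "y \<in> D (act g x)"
    then obtain y' where "y' \<in> P" "y = act g y'"
      using surj_prop[OF g] by (auto simp: D_def)
    then show "y \<in> act g ` D x"
      using y x g oa by (auto simp: D_def order_action_def)
  qed
  moreover have finD: "finite (D z)" for z using fin by (simp add: D_def)
  ultimately have "card (D (act g x)) \<le> card (D x)"
    by (meson card_image_le card_mono finite_imageI order_trans)
  then have "D x = D (act g x)" using card_seteq[OF finD sub] by simp
  then have "(act g x, x) \<in> r" using x r_refl by (auto simp: D_def)
  then show ?thesis using r_antisym le by blast
qed

text \<open>The category axioms follow by lifting composable morphisms to a chain in the poset. A pair
  of opposite morphisms lifts to \<open>x \<le> y \<le> g x\<close>, which collapses to a point.\<close>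

lemma acyclic_category_quotient:
  assumes "finite P"
  shows "acyclic_category (quotient_category G P r act)"
proof
  let ?Q = "quotient_category G P r act"
  have Obj: "X \<in> Obj ?Q \<longleftrightarrow> (\<exists>a\<in>P. X = orbit G act a)" for X
    by (auto simp: quotient_category_def orbits_def)
  show "a \<in> Obj ?Q \<and> b \<in> Obj ?Q" if "m \<in> Hom ?Q a b" for m a b
    using quotient_HomE[OF that] rP Obj by metis
  show "Idn ?Q a \<in> Hom ?Q a a" if "a \<in> Obj ?Q" for a
    using that mor_class_Hom r_refl by (auto simp: Obj quotient_Idn)
  show "Cmp ?Q n m \<in> Hom ?Q a c" if m: "m \<in> Hom ?Q a b" and n: "n \<in> Hom ?Q b c" for m n a b c
  proof -
    obtain x y where xy: "(x, y) \<in> r" "m = mor_class G r act (x, y)"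
      "a = orbit G act x" "b = orbit G act y"
      using quotient_HomE[OF m] by metis
    obtain z where yz: "(y, z) \<in> r" "n = mor_class G r act (y, z)" "c = orbit G act z"
      using quotient_Hom_lift_source[OF n[unfolded xy(4)]] rP[OF xy(1)] by blast
    show ?thesis
      using xy yz quotient_Cmp[OF xy(1) yz(1)] mor_class_Hom r_trans by metis
  qed
  show "Cmp ?Q (Cmp ?Q k n) m = Cmp ?Q k (Cmp ?Q n m)"
    if m: "m \<in> Hom ?Q a b" and n: "n \<in> Hom ?Q b c" and k: "k \<in> Hom ?Q c d" for m n k a b c d
  proof -
    obtain x y where xy: "(x, y) \<in> r" "m = mor_class G r act (x, y)" "b = orbit G act y"
      using quotient_HomE[OF m] by metis
    obtain z where yz: "(y, z) \<in> r" "n = mor_class G r act (y, z)" "c = orbit G act z"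
      using quotient_Hom_lift_source[OF n[unfolded xy(3)]] rP[OF xy(1)] by blast
    obtain w where zw: "(z, w) \<in> r" "k = mor_class G r act (z, w)"
      using quotient_Hom_lift_source[OF k[unfolded yz(3)]] rP[OF yz(1)] by blast
    have "(x, z) \<in> r" "(y, w) \<in> r" using xy yz zw r_trans by blast+
    then show ?thesis using xy yz zw by (simp add: quotient_Cmp)
  qed
  show "Cmp ?Q m (Idn ?Q a) = m" if m: "m \<in> Hom ?Q a b" for m a b
  proof -
    obtain x y where "(x, y) \<in> r" "m = mor_class G r act (x, y)" "a = orbit G act x"
      using quotient_HomE[OF m] by metis
    then show ?thesis using rP r_refl by (auto simp: quotient_Idn quotient_Cmp)
  qed
  show "Cmp ?Q (Idn ?Q b) m = m" if m: "m \<in> Hom ?Q a b" for m a b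
  proof -
    obtain x y where "(x, y) \<in> r" "m = mor_class G r act (x, y)" "b = orbit G act y"
      using quotient_HomE[OF m] by metis
    then show ?thesis using rP r_refl by (auto simp: quotient_Idn quotient_Cmp)
  qed
  show "m = Idn ?Q a" if m: "m \<in> Hom ?Q a b" and n: "n \<in> Hom ?Q b a" for m n a b
  proof -
    obtain x y where xy: "(x, y) \<in> r" "m = mor_class G r act (x, y)"
      "a = orbit G act x" "b = orbit G act y"
      using quotient_HomE[OF m] by metis
    obtain z where yz: "(y, z) \<in> r" "a = orbit G act z"
      using quotient_Hom_lift_source[OF n[unfolded xy(4)]] rP[OF xy(1)] by blast
    obtain g where g: "g \<in> carrier G" "z = act g x"
      using orbit_eqD[of x z] xy(3) yz rP[OF yz(1)] by metis
    have "z = x" using orbit_antichain[OF assms g(1)] r_trans[OF xy(1) yz(1)] g(2) by simp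
    then have "x = y" using r_antisym xy(1) yz(1) by blast
    then show ?thesis using xy quotient_Idn rP by blast
  qed
qed

end


section \<open>The coreflection induced by a closure operator\<close>

locale equivariant_closure_operator = poset_action G P r act
  for G :: "('g, 'x) monoid_scheme" and P :: "'a set" and r act +
  fixes \<phi> :: "'a \<Rightarrow> 'a"
  assumes descending_closure: "descending_closure_operator P r \<phi>"
    and equivariant: "equivariant G P act \<phi>"
begin

lemma closure_in: "x \<in> P \<Longrightarrow> \<phi> x \<in> P"
  using descending_closure by (auto simp: descending_closure_operator_def)

lemma closure_mono: "(x, y) \<in> r \<Longrightarrow> (\<phi> x, \<phi> y) \<in> r"
  using descending_closure rP[of x y]
  by (simp add: descending_closure_operator_def monotone_on_def)

lemma closure_idem: "x \<in> P \<Longrightarrow> \<phi> (\<phi> x) = \<phi> x"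
  using descending_closure by (simp add: descending_closure_operator_def)

lemma closure_le: "x \<in> P \<Longrightarrow> (\<phi> x, x) \<in> r"
  using descending_closure by (simp add: descending_closure_operator_def)

lemma closure_act: "g \<in> carrier G \<Longrightarrow> x \<in> P \<Longrightarrow> \<phi> (act g x) = act g (\<phi> x)"
  using equivariant by (simp add: equivariant_def)

lemma decomposition_closure:
  assumes "decomposition r z zs"
  shows "decomposition r (map_prod \<phi> \<phi> z) (map (map_prod \<phi> \<phi>) zs)"
proof -
  have "successively (\<lambda>u v. snd u = fst v) (map (map_prod \<phi> \<phi>) zs)"
    unfolding successively_map
    by (rule successively_mono[where P = "\<lambda>u v. snd u = fst v"])
      (use assms in \<open>auto simp: decomposition_def\<close>)
  then show ?thesis
    using assms closure_mono by (auto simp: decomposition_def hd_map last_map)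
qed

lemma mor_step_closure:
  assumes "(z, w) \<in> mor_step G r act"
  shows "(map_prod \<phi> \<phi> z, map_prod \<phi> \<phi> w) \<in> mor_step G r act"
proof -
  obtain zs ws where d: "decomposition r z zs" "decomposition r w ws"
    and l: "list_all2 (\<lambda>u v. mor_orbit G act u = mor_orbit G act v) zs ws"
    using assms by (auto simp: mor_step_def)
  have orbits: "mor_orbit G act (map_prod \<phi> \<phi> u) = mor_orbit G act (map_prod \<phi> \<phi> v)"
    if same: "mor_orbit G act u = mor_orbit G act v" and "u \<in> r" "v \<in> r" for u v
  proof -
    obtain a b c e where uv: "u = (a, b)" "v = (c, e)" by (cases u, cases v) auto
    have P: "a \<in> P" "b \<in> P" "c \<in> P" "e \<in> P" using rP that uv by auto
    obtain g where g: "g \<in> carrier G" "c = act g a" "e = act g b"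
      using mor_orbit_eqD[OF same[unfolded uv] P(3,4)] by blast
    then show ?thesis using P by (simp add: uv closure_act closure_in mor_orbit_eqI)
  qed
  have "set zs \<subseteq> r" "set ws \<subseteq> r" using d by (auto simp: decomposition_def)
  then have "list_all2 (\<lambda>u v. mor_orbit G act u = mor_orbit G act v)
      (map (map_prod \<phi> \<phi>) zs) (map (map_prod \<phi> \<phi>) ws)"
    unfolding list.rel_map by (intro list.rel_mono_strong[OF l] orbits) auto
  then show ?thesis
    using decomposition_closure d unfolding mor_step_def by blast
qed

text \<open>So \<open>\<phi>\<close> acts on the morphisms of the quotient: applied to all factors, it carries
  decompositions with factorwise equal orbits to decompositions of the same kind.\<close>

lemma mor_class_closure:
  assumes "mor_class G r act (a, b) = mor_class G r act (c, d)"
  shows "mor_class G r act (\<phi> a, \<phi> b) = mor_class G r act (\<phi> c, \<phi> d)"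
proof -
  have "((a, b), (c, d)) \<in> (mor_step G r act)\<^sup>*" using assms mor_class_eq_iff by blast
  then have "((\<phi> a, \<phi> b), (\<phi> c, \<phi> d)) \<in> (mor_step G r act)\<^sup>*"
  proof (induction rule: rtrancl_induct2)
    case (step a1 b1 a2 b2)
    then show ?case using mor_step_closure[OF step.hyps(2)] by simp
  qed simp
  then show ?thesis using mor_class_eq_iff by blast
qed

text \<open>On objects the induced functor is thus the image map, which needs no choice of
  representatives.\<close>

lemma closure_image_orbit:
  assumes "b \<in> P"
  shows "\<phi> ` orbit G act b = orbit G act (\<phi> b)"
proof -
  have "\<phi> ` orbit G act b = (\<lambda>g. \<phi> (act g b)) ` carrier G" by (auto simp: orbit_def)
  also have "\<dots> = (\<lambda>g. act g (\<phi> b)) ` carrier G" using closure_act assms by (intro image_cong) auto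
  finally show ?thesis by (auto simp: orbit_def)
qed

text \<open>Every lift of a red object is a fixed point, not only the representatives of the form
  \<open>\<phi> p\<close>.\<close>

lemma closure_fixes_orbit:
  assumes "orbit G act (\<phi> p) = orbit G act a" "p \<in> P" "a \<in> P"
  shows "\<phi> a = a"
proof -
  obtain g where "g \<in> carrier G" "a = act g (\<phi> p)" using orbit_eqD[OF assms(1,3)] by blast
  then show ?thesis using closure_act closure_in closure_idem assms(2) by simp
qed

text \<open>A lift \<open>a \<le> b\<close> of \<open>m\<close> starts at a fixed point, whence \<open>a \<le> \<phi> b\<close>. For
  uniqueness, the composite of a factor \<open>c \<le> \<phi> b\<close> with the counit is the class of \<open>c \<le> b\<close>;
  applying \<open>\<phi>\<close> gives back the class of \<open>c \<le> \<phi> b\<close>, which therefore depends only on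
  \<open>m\<close>.\<close>

lemma closure_factorization:
  assumes p: "p \<in> P" and b: "b \<in> P"
    and m: "m \<in> Hom (quotient_category G P r act) (orbit G act (\<phi> p)) (orbit G act b)"
  shows "\<exists>!n. n \<in> Hom (quotient_category G P r act) (orbit G act (\<phi> p)) (orbit G act (\<phi> b)) \<and>
    Cmp (quotient_category G P r act) (mor_class G r act (\<phi> b, b)) n = m"
proof -
  let ?Q = "quotient_category G P r act"
  obtain a where a: "(a, b) \<in> r" "m = mor_class G r act (a, b)"
    "orbit G act (\<phi> p) = orbit G act a"
    using quotient_Hom_lift_target[OF m b] by blast
  have \<phi>a: "\<phi> a = a" using closure_fixes_orbit[OF a(3) p] rP[OF a(1)] by blast
  have ab: "(a, \<phi> b) \<in> r" using closure_mono[OF a(1)] unfolding \<phi>a .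
  show ?thesis
  proof (rule ex1I)
    have "mor_class G r act (a, \<phi> b) \<in> Hom ?Q (orbit G act (\<phi> p)) (orbit G act (\<phi> b))"
      unfolding a(3) by (rule mor_class_Hom[OF ab])
    moreover have "Cmp ?Q (mor_class G r act (\<phi> b, b)) (mor_class G r act (a, \<phi> b)) = m"
      unfolding a(2) by (rule quotient_Cmp[OF ab closure_le[OF b]])
    ultimately show "mor_class G r act (a, \<phi> b)
          \<in> Hom ?Q (orbit G act (\<phi> p)) (orbit G act (\<phi> b)) \<and>
        Cmp ?Q (mor_class G r act (\<phi> b, b)) (mor_class G r act (a, \<phi> b)) = m" ..
  next
    fix n
    assume "n \<in> Hom ?Q (orbit G act (\<phi> p)) (orbit G act (\<phi> b)) \<and>
      Cmp ?Q (mor_class G r act (\<phi> b, b)) n = m"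
    then have n: "n \<in> Hom ?Q (orbit G act (\<phi> p)) (orbit G act (\<phi> b))"
      "Cmp ?Q (mor_class G r act (\<phi> b, b)) n = m" by blast+
    obtain c where c: "(c, \<phi> b) \<in> r" "n = mor_class G r act (c, \<phi> b)"
      "orbit G act (\<phi> p) = orbit G act c"
      using quotient_Hom_lift_target[OF n(1) closure_in[OF b]] by blast
    have \<phi>c: "\<phi> c = c" using closure_fixes_orbit[OF c(3) p] rP[OF c(1)] by blast
    have "mor_class G r act (c, b) = mor_class G r act (a, b)"
      using n(2) unfolding a(2) c(2) quotient_Cmp[OF c(1) closure_le[OF b]] .
    from mor_class_closure[OF this] show "n = mor_class G r act (a, \<phi> b)"
      unfolding \<phi>c \<phi>a c(2) .
  qed
qed

lemma coreflective_subcategory_quotient: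
  assumes "finite P"
  shows "coreflective_subcategory (quotient_category G P r act)
    {orbit G act (\<phi> p) | p. p \<in> P} ((`) \<phi>)"
proof -
  let ?Q = "quotient_category G P r act"
  let ?R = "{orbit G act (\<phi> p) | p. p \<in> P}"
  interpret acyclic_category ?Q by (rule acyclic_category_quotient[OF assms])
  have Obj: "\<exists>a\<in>P. X = orbit G act a" if "X \<in> Obj ?Q" for X
    using that by (auto simp: quotient_category_def orbits_def)
  show ?thesis
  proof
    show "?R \<subseteq> Obj ?Q" using closure_in by (auto simp: quotient_category_def orbits_def)
  next
    fix B assume "B \<in> Obj ?Q"
    then obtain b where b: "b \<in> P" "B = orbit G act b" using Obj by blast
    have fB: "\<phi> ` B = orbit G act (\<phi> b)"
      unfolding b(2) by (rule closure_image_orbit[OF b(1)])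
    show "\<phi> ` B \<in> ?R" unfolding fB using b(1) by blast
    show "\<exists>e\<in>Hom ?Q (\<phi> ` B) B. \<forall>X\<in>?R. \<forall>m\<in>Hom ?Q X B.
        \<exists>!n. n \<in> Hom ?Q X (\<phi> ` B) \<and> Cmp ?Q e n = m"
      unfolding fB unfolding b(2)
    proof (intro bexI ballI)
      show "mor_class G r act (\<phi> b, b) \<in> Hom ?Q (orbit G act (\<phi> b)) (orbit G act b)"
        by (rule mor_class_Hom[OF closure_le[OF b(1)]])
    next
      fix X m assume "X \<in> ?R" and m: "m \<in> Hom ?Q X (orbit G act b)"
      then obtain p where p: "p \<in> P" "X = orbit G act (\<phi> p)" by blast
      show "\<exists>!n. n \<in> Hom ?Q X (orbit G act (\<phi> b)) \<and>
          Cmp ?Q (mor_class G r act (\<phi> b, b)) n = m"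
        unfolding p(2) by (rule closure_factorization[OF p(1) b(1) m[unfolded p(2)]])
    qed
  qed
qed

end

theorem proposition13:
  fixes G :: "('g, 'x) monoid_scheme"
    and P :: "'a set" and r :: "('a \<times> 'a) set"
    and act :: "'g \<Rightarrow> 'a \<Rightarrow> 'a" and \<phi> :: "'a \<Rightarrow> 'a"
  assumes "finite P" and "partial_order_on P r"
    and "order_action G P r act"
    and "descending_closure_operator P r \<phi>"
    and "equivariant G P act \<phi>"
  shows "trisp_closure_map (nerve (quotient_category G P r act))
           (simplices (nerve (quotient_category G P r act)) 0 - red_vertices G P act \<phi>)
           (red_vertices G P act \<phi>)
           (induced_map G P act \<phi>)"
proof -
  interpret equivariant_closure_operator G P r act \<phi>
    by unfold_locales (use assms in auto)
  interpret coreflective_subcategory "quotient_category G P r act"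
    "{orbit G act (\<phi> p) | p. p \<in> P}" "(`) \<phi>"
    by (rule coreflective_subcategory_quotient[OF assms(1)])
  have red: "red_vertices G P act \<phi> = nerve_vertex ` {orbit G act (\<phi> p) | p. p \<in> P}"
    by (auto simp: red_vertices_def orbit_vertex_def)
  have "induced_map G P act \<phi> (nerve_vertex B) = nerve_vertex (\<phi> ` B)"
    if B: "B \<in> Obj (quotient_category G P r act)" for B
  proof -
    obtain b where "b \<in> P" "B = orbit G act b"
      using B by (auto simp: quotient_category_def orbits_def)
    then show ?thesis
      using induced_map_orbit_vertex[OF assms(4,5)] closure_image_orbit
      by (simp add: orbit_vertex_def)
  qed
  then show ?thesis
    unfolding red by (intro trisp_closure_map_coreflection) auto
qed

end
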